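(* Let $-\infty<a<b<\infty$, let $1\leq p,q<\infty$, $\alpha\in\left(\frac1q,1\right]$, $s\in[0,1]$, and let $\gamma>0$ be given by $$\frac{\gamma s}{q}+\frac{\gamma(1-s)}{p}=1.$$ Then there is a constant $C>0$, independent of $u$, such that for every $u\in AC[a,b]$ with $u(a)=0$, $$\|u\|_{L^{\gamma}(a, b)}\leq C\,\|\partial^{\alpha}_{a+} u\|_{L^{q}(a, b)}^{s}\, \|u\|_{L^{p}(a, b)}^{1-s},$$ where $\partial^\alpha_{a+}$ is the left Caputo fractional derivative of order $\alpha$.
   Context: $AC[a,b]$ is the space of (real- or complex-valued) absolutely continuous functions on $[a,b]$, and $\Gamma$ is the Euler gamma function. For $\alpha>0$ the left Riemann--Liouville integral is $I_{a+}^\alpha f(t)=\frac{1}{\Gamma(\alpha)}\int_a^t (t-s)^{\alpha-1}f(s)\,ds$, $t\in(a,b]$, and $I_{a+}^0 f=f$. For $0<\alpha\le 1$ and $f\in AC[a,b]$ the left Caputo fractional derivative is $\partial_{a+}^\alpha f(t)=I_{a+}^{1-\alpha}f'(t)$ (defined for almost every $t$); in particular $\partial_{a+}^1 f=f'$. Norms take values in $[0,\infty]$ (so the inequality has content only if the right-hand side is finite), and any quantity raised to the power $0$ is $1$. For $r>0$, $\|u\|_{L^r(a,b)}=\left(\int_a^b|u|^r\,dx\right)^{1/r}$. *)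

theory Defs
  imports "HOL-Analysis.Analysis"
begin

definition AC :: "real \<Rightarrow> real \<Rightarrow> (real \<Rightarrow> 'a::real_normed_vector) set" where
  "AC a b = {f. \<forall>\<epsilon>>0. \<exists>\<delta>>0. \<forall>(n::nat) c d.
      (\<forall>i<n. a \<le> c i \<and> c i < d i \<and> d i \<le> b) \<longrightarrow>
      disjoint_family_on (\<lambda>i. {c i<..<d i}) {..<n} \<longrightarrow>
      (\<Sum>i<n. d i - c i) < \<delta> \<longrightarrow>
      (\<Sum>i<n. norm (f (d i) - f (c i))) < \<epsilon>}"

definition RL_integral ::
    "real \<Rightarrow> real \<Rightarrow> (real \<Rightarrow> 'a::{banach, second_countable_topology}) \<Rightarrow> real \<Rightarrow> 'a" where
  "RL_integral a \<alpha> f t =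
     (if \<alpha> = 0 then f t
      else (1 / Gamma \<alpha>) *\<^sub>R (LINT s:{a<..<t}|lebesgue. (t - s) powr (\<alpha> - 1) *\<^sub>R f s))"

(* For f in AC a b, vector_derivative f (at s) is the classical derivative f'(s) at almost every s
   in (a, b). On the exceptional null set it is an unspecified value, which does not affect the
   integral; since that null set need not be Borel, all integrals are taken over lebesgue
   (the completion) rather than lborel. *)
definition caputo_deriv ::
    "real \<Rightarrow> real \<Rightarrow> (real \<Rightarrow> 'a::{banach, second_countable_topology}) \<Rightarrow> real \<Rightarrow> 'a" where
  "caputo_deriv a \<alpha> f = RL_integral a (1 - \<alpha>) (\<lambda>s. vector_derivative f (at s))"

(* Powers of elements of [0, \<infinity>], meant for exponents r \<ge> 0, with x^0 = 1 for every x including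
   0 and \<infinity> (whereas 0 powr 0 = 0 on the reals). *)
definition ennreal_powr :: "ennreal \<Rightarrow> real \<Rightarrow> ennreal" where
  "ennreal_powr x r =
     (if r = 0 then 1 else if x = \<infinity> then \<infinity> else ennreal (enn2real x powr r))"

definition Lnorm :: "real \<Rightarrow> real \<Rightarrow> real \<Rightarrow> (real \<Rightarrow> 'a::real_normed_vector) \<Rightarrow> ennreal" where
  "Lnorm r a b u =
     ennreal_powr (\<integral>\<^sup>+ x \<in> {a<..<b}. ennreal (norm (u x) powr r) \<partial>lebesgue) (1 / r)"

end

theory Submission
  imports Defs
begin

text \<open>The hypotheses force \<open>q > 1\<close>. Since \<open>u\<close> is the integral of its almost everywhere derivative,
  Fubini's theorem and the Beta integral give the representation of \<open>u\<close> as the fractional integral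
  of order \<open>\<alpha>\<close> of its Caputo derivative. As \<open>\<alpha> > 1/q\<close>, the kernel lies in the dual of \<open>L\<^sup>q\<close>, so
  Hoelder's inequality bounds the supremum of \<open>u\<close>, and with it the \<open>L\<^sup>q\<close> norm of \<open>u\<close>, by the
  \<open>L\<^sup>q\<close> norm of the derivative. The claim is then the interpolation of \<open>L\<^sup>\<gamma>\<close> between \<open>L\<^sup>q\<close>
  and \<open>L\<^sup>p\<close>.

  The fundamental theorem of calculus for absolutely continuous functions rests on the almost
  everywhere differentiability of monotone functions, which follows from Vitali's covering theorem,
  and on a gauge argument in which the exceptional null set is absorbed by absolute continuity.\<close>

section \<open>Differentiability of monotone functions\<close>

text \<open>The only quantitative input is the norm of the kernel
  \<open>(t - \<tau>) powr (\<alpha> - 1)\<close> in L^q', where 1/q + 1/q' = 1. It is finite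
  exactly when (\<alpha> - 1) q' > -1, that is \<alpha> > 1/q, and q = 1 is excluded because it
  would leave 1 < \<alpha> \<le> 1. The final constant is this norm over an interval of length b -
  a, divided by \<open>Gamma \<alpha>\<close>, times \<open>(b - a) powr (1 / q)\<close> for the
  passage from the supremum to L^q, all raised to the power s. Three obstacles shape the rest. The
  derivative exists only almost everywhere and is measurable only for the completed measure, so
  Fubini's theorem is used on a product of two completions. The gauge integral recovers u from this
  derivative but does not make the derivative Lebesgue integrable; bounded variation does. Finally,
  norms may be infinite, and since infinity times 0 is 0, an infinite norm of the Caputo derivative
  does not by itself make the right-hand side infinite.\<close>

lemma Vitali_covering_intervals:
  fixes S :: "real set"
  assumes U: "\<And>U. U \<in> \<U> \<Longrightarrow> open U" "S \<subseteq> \<Union>\<U>"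
    and S: "\<And>x \<delta>. x \<in> S \<Longrightarrow> 0 < \<delta> \<Longrightarrow> \<exists>c d. c < d \<and> c \<le> x \<and> x \<le> d \<and> d - c < \<delta> \<and> P c d"
  obtains C where "countable C" "disjoint_family_on (\<lambda>(c, d). {c..d}) C"
    "\<And>c d. (c, d) \<in> C \<Longrightarrow> c < d \<and> (\<exists>U\<in>\<U>. {c..d} \<subseteq> U) \<and> P c d"
    "negligible (S - (\<Union>(c, d)\<in>C. {c..d}))"
proof -
  define K where "K = {(c, d). c < d \<and> (\<exists>U\<in>\<U>. {c..d} \<subseteq> U) \<and> P c d}"
  \<comment> \<open>An interval is the closed ball about its midpoint, so the covering theorem for
    balls applies to pairs of end points.\<close>
  have cb: "cball ((fst i + snd i) / 2) ((snd i - fst i) / 2) = (case i of (c, d) \<Rightarrow> {c..d})" for i :: "real \<times> real"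
    by (cases i) (auto simp: cball_eq_atLeastAtMost field_simps)
  obtain C where C: "countable C" "C \<subseteq> K"
    "pairwise (\<lambda>i j. disjnt (cball ((fst i + snd i) / 2) ((snd i - fst i) / 2))
                           (cball ((fst j + snd j) / 2) ((snd j - fst j) / 2))) C"
    "negligible (S - (\<Union>i\<in>C. cball ((fst i + snd i) / 2) ((snd i - fst i) / 2)))"
  proof (rule Vitali_covering_theorem_cballs[of K "\<lambda>i. (snd i - fst i) / 2" S "\<lambda>i. (fst i + snd i) / 2"])
    show "0 < (snd i - fst i) / 2" if "i \<in> K" for i
      using that by (auto simp: K_def)
    show "\<exists>i. i \<in> K \<and> x \<in> cball ((fst i + snd i) / 2) ((snd i - fst i) / 2) \<and> (snd i - fst i) / 2 < \<delta>"
      if x: "x \<in> S" "0 < \<delta>" for x \<delta>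
    proof -
      obtain U e where e: "U \<in> \<U>" "e > 0" "ball x e \<subseteq> U"
        using U x by (meson UnionE openE subsetD)
      \<comment> \<open>An interval that contains x and is shorter than e stays in the ball of
        radius e about x, hence in one member of \<open>\<U>\<close>.\<close>
      obtain c d where *: "c < d" "c \<le> x" "x \<le> d" "d - c < min \<delta> e" "P c d"
        using S[of x "min \<delta> e"] x e by auto
      moreover have "{c..d} \<subseteq> ball x e"
        using * by (auto simp: ball_eq_greaterThanLessThan)
      ultimately have "(c, d) \<in> K"
        using e unfolding K_def by blast
      with * show ?thesis
        unfolding cb by (intro exI[of _ "(c, d)"]) auto
    qed
  qed
  show thesis
  proof (rule that[of C])
    show "c < d \<and> (\<exists>U\<in>\<U>. {c..d} \<subseteq> U) \<and> P c d" if "(c, d) \<in> C" for c d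
      using that C(2) unfolding K_def by blast
  qed (use C in \<open>simp_all add: cb disjoint_family_on_def pairwise_def disjnt_def\<close>)
qed

lemma emeasure_disjoint_Icc:
  fixes C :: "(real \<times> real) set"
  assumes "countable C" "disjoint_family_on (\<lambda>(c, d). {c..d}) C" "\<And>c d. (c, d) \<in> C \<Longrightarrow> c < d"
  shows "emeasure lborel (\<Union>(c, d)\<in>C. {c..d}) = (\<integral>\<^sup>+i. ennreal (snd i - fst i) \<partial>count_space C)"
proof -
  have "emeasure lborel (\<Union>(c, d)\<in>C. {c..d}) = (\<integral>\<^sup>+i. emeasure lborel (case i of (c, d) \<Rightarrow> {c..d}) \<partial>count_space C)"
    using assms by (intro emeasure_UN_countable) auto
  also have "\<dots> = (\<integral>\<^sup>+i. ennreal (snd i - fst i) \<partial>count_space C)"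
    using assms(3) by (intro nn_integral_cong) (auto simp: less_imp_le)
  finally show ?thesis .
qed

text \<open>The image intervals of disjoint intervals under a monotone function are again disjoint,
  so sums of increments over countable families can be compared by monotonicity of measure.\<close>

lemma emeasure_mono_image_Ioo:
  fixes C :: "(real \<times> real) set"
  assumes "countable C" "disjoint_family_on (\<lambda>(c, d). {c..d}) C" "\<And>c d. (c, d) \<in> C \<Longrightarrow> c < d"
    and f: "mono f"
  shows "emeasure lborel (\<Union>(c, d)\<in>C. {f c<..<f d}) = (\<integral>\<^sup>+i. ennreal (f (snd i) - f (fst i)) \<partial>count_space C)"
proof -
  have "disjoint_family_on (\<lambda>(c, d). {f c<..<f d}) C"
    unfolding disjoint_family_on_def
  proof (intro ballI impI)
    fix i j assume ij: "i \<in> C" "j \<in> C" "i \<noteq> j"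
    obtain c d c' d' where [simp]: "i = (c, d)" "j = (c', d')" by (cases i, cases j)
    have *: "(c, d) \<in> C" "(c', d') \<in> C" using ij by auto
    have "{c..d} \<inter> {c'..d'} = {}"
      using assms(2) ij unfolding disjoint_family_on_def by fastforce
    moreover have "c < d" "c' < d'" using * assms(3) by auto
    ultimately have "d < c' \<or> d' < c"
      by (simp add: Int_atLeastAtMost) linarith
    then have "f d \<le> f c' \<or> f d' \<le> f c"
      using f by (auto simp: mono_def)
    then show "(case i of (c, d) \<Rightarrow> {f c<..<f d}) \<inter> (case j of (c, d) \<Rightarrow> {f c<..<f d}) = {}" by auto
  qed
  then have "emeasure lborel (\<Union>(c, d)\<in>C. {f c<..<f d}) = (\<integral>\<^sup>+i. emeasure lborel (case i of (c, d) \<Rightarrow> {f c<..<f d}) \<partial>count_space C)"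
    using assms by (intro emeasure_UN_countable) auto
  also have "\<dots> = (\<integral>\<^sup>+i. ennreal (f (snd i) - f (fst i)) \<partial>count_space C)"
  proof (intro nn_integral_cong)
    fix i assume "i \<in> space (count_space C)"
    then have "f (fst i) \<le> f (snd i)"
      using f assms(3)[of "fst i" "snd i"] by (auto simp: mono_def)
    then show "emeasure lborel (case i of (c, d) \<Rightarrow> {f c<..<f d}) = ennreal (f (snd i) - f (fst i))"
      by (auto simp: split_beta)
  qed
  finally show ?thesis .
qed

text \<open>Disjointness turns the slope bound into a comparison of measures, with increments read
  as lengths of image intervals. A family \<open>\<U>\<close> stands in place of one open set
  because in the nested covering each small interval has to lie inside a single interval of the
  first covering.\<close>

lemma Vitali_increment_ge:
  fixes f :: "real \<Rightarrow> real"
  assumes f: "mono f" and R: "0 < R" and U: "\<And>U. U \<in> \<U> \<Longrightarrow> open U" "S \<subseteq> \<Union>\<U>"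
    and S: "\<And>x \<delta>. x \<in> S \<Longrightarrow> 0 < \<delta> \<Longrightarrow>
      \<exists>c d. c < d \<and> c \<le> x \<and> x \<le> d \<and> d - c < \<delta> \<and> R * (d - c) \<le> f d - f c"
  obtains C where "countable C" "\<And>c d. (c, d) \<in> C \<Longrightarrow> c < d \<and> (\<exists>U\<in>\<U>. {c..d} \<subseteq> U)"
    "negligible (S - (\<Union>(c, d)\<in>C. {c..d}))"
    "ennreal R * emeasure lborel (\<Union>(c, d)\<in>C. {c..d}) \<le> emeasure lborel (\<Union>(c, d)\<in>C. {f c<..<f d})"
proof -
  obtain C where C: "countable C" "disjoint_family_on (\<lambda>(c, d). {c..d}) C"
    "\<And>c d. (c, d) \<in> C \<Longrightarrow> c < d \<and> (\<exists>U\<in>\<U>. {c..d} \<subseteq> U) \<and> R * (d - c) \<le> f d - f c"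
    "negligible (S - (\<Union>(c, d)\<in>C. {c..d}))"
    by (rule Vitali_covering_intervals[OF U, of "\<lambda>c d. R * (d - c) \<le> f d - f c"]) (use S in blast)+
  note meas = emeasure_disjoint_Icc[OF C(1,2)] emeasure_mono_image_Ioo[OF C(1,2) _ f]
  have "ennreal R * emeasure lborel (\<Union>(c, d)\<in>C. {c..d}) = (\<integral>\<^sup>+i. ennreal R * ennreal (snd i - fst i) \<partial>count_space C)"
    using C(3) by (simp add: meas nn_integral_cmult)
  also have "\<dots> \<le> (\<integral>\<^sup>+i. ennreal (f (snd i) - f (fst i)) \<partial>count_space C)"
    using C(3) R by (intro nn_integral_mono) (auto simp flip: ennreal_mult' intro!: ennreal_leI)
  also have "\<dots> = emeasure lborel (\<Union>(c, d)\<in>C. {f c<..<f d})"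
    using C(3) by (simp add: meas)
  finally show thesis
    using C by (intro that[of C]) auto
qed

text \<open>Counterpart for small slopes. One open set suffices, since the first covering only has
  to keep its total length below the measure of \<open>U\<close>.\<close>

lemma Vitali_increment_le:
  fixes f :: "real \<Rightarrow> real"
  assumes f: "mono f" and r: "0 \<le> r" and U: "open U" "S \<subseteq> U"
    and S: "\<And>x \<delta>. x \<in> S \<Longrightarrow> 0 < \<delta> \<Longrightarrow>
      \<exists>c d. c < d \<and> c \<le> x \<and> x \<le> d \<and> d - c < \<delta> \<and> f d - f c \<le> r * (d - c)"
  obtains C where "countable C" "\<And>c d. (c, d) \<in> C \<Longrightarrow> c < d \<and> {c..d} \<subseteq> U"
    "negligible (S - (\<Union>(c, d)\<in>C. {c..d}))"
    "emeasure lborel (\<Union>(c, d)\<in>C. {f c<..<f d}) \<le> ennreal r * emeasure lborel (\<Union>(c, d)\<in>C. {c..d})"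
proof -
  obtain C where C: "countable C" "disjoint_family_on (\<lambda>(c, d). {c..d}) C"
    "\<And>c d. (c, d) \<in> C \<Longrightarrow> c < d \<and> {c..d} \<subseteq> U \<and> f d - f c \<le> r * (d - c)"
    "negligible (S - (\<Union>(c, d)\<in>C. {c..d}))"
    by (rule Vitali_covering_intervals[of "{U}" S "\<lambda>c d. f d - f c \<le> r * (d - c)"]) (use U S in auto)
  note meas = emeasure_disjoint_Icc[OF C(1,2)] emeasure_mono_image_Ioo[OF C(1,2) _ f]
  have "emeasure lborel (\<Union>(c, d)\<in>C. {f c<..<f d}) = (\<integral>\<^sup>+i. ennreal (f (snd i) - f (fst i)) \<partial>count_space C)"
    using C(3) by (simp add: meas)
  also have "\<dots> \<le> (\<integral>\<^sup>+i. ennreal r * ennreal (snd i - fst i) \<partial>count_space C)"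
    using C(3) r by (intro nn_integral_mono) (auto simp flip: ennreal_mult' intro!: ennreal_leI)
  also have "\<dots> = ennreal r * emeasure lborel (\<Union>(c, d)\<in>C. {c..d})"
    using C(3) by (simp add: meas nn_integral_cmult)
  finally show thesis
    using C by (intro that[of C]) auto
qed

text \<open>\<open>W\<close> catches \<open>S\<close> only up to a null set, and \<open>S\<close>
  itself need not be measurable; \<open>S \<union> W\<close> is the measurable superset that
  estimates of outer measure ask for.\<close>

lemma lmeasurable_almost_cover:
  assumes neg: "negligible (S - W)" and W: "W \<in> sets lborel" and le: "emeasure lborel W \<le> ennreal m" and m: "0 \<le> m"
  shows "S \<union> W \<in> lmeasurable" "measure lebesgue (S \<union> W) \<le> m"
proof -
  have fin: "emeasure lborel W < \<infinity>"
    using le by (rule le_less_trans) auto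
  then have Wm: "W \<in> lmeasurable" using W by (auto simp: fmeasurable_def)
  have eq: "S \<union> W = (S - W) \<union> W" by auto
  show "S \<union> W \<in> lmeasurable"
    unfolding eq using neg Wm by (intro fmeasurable.Un) (auto simp: negligible_imp_measurable)
  have "measure lebesgue (S \<union> W) \<le> measure lebesgue (S - W) + measure lebesgue W"
    unfolding eq using neg Wm by (intro measure_Un_le) (auto simp: negligible_imp_sets fmeasurableD)
  also have "\<dots> = measure lborel W" using neg W by (simp add: negligible_imp_measure0)
  also have "\<dots> \<le> m" using fin le m
    by (simp add: emeasure_eq_ennreal_measure)
  finally show "measure lebesgue (S \<union> W) \<le> m" .
qed

lemma lmeasurable_open_cover:
  fixes T :: "'a::euclidean_space set"
  assumes T: "T \<in> lmeasurable" and e: "0 < e"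
  obtains U where "open U" "T \<subseteq> U" "U \<in> lmeasurable" "measure lebesgue U < measure lebesgue T + e"
proof -
  obtain U where U: "open U" "T \<subseteq> U" "U - T \<in> lmeasurable" "emeasure lebesgue (U - T) < ennreal e"
    using sets_lebesgue_outer_open[OF fmeasurableD[OF T] e] by metis
  have eq: "U = T \<union> (U - T)" using U(2) by auto
  have "U \<in> lmeasurable" by (subst eq) (intro fmeasurable.Un T U)
  have "measure lebesgue U \<le> measure lebesgue T + measure lebesgue (U - T)"
    by (subst eq, intro measure_Un_le) (use T U in \<open>auto simp: fmeasurableD\<close>)
  also have "measure lebesgue (U - T) < e"
    using U(3,4) e by (simp only: emeasure_eq_measure2 ennreal_less_iff measure_nonneg)
  finally show thesis
    using U \<open>U \<in> lmeasurable\<close> by (intro that[of U]) auto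
qed

lemma negligible_localize:
  assumes "\<And>n::nat. negligible (S \<inter> {-real n<..<real n})"
  shows "negligible S"
proof -
  have "negligible (\<Union>n::nat. S \<inter> {-real n<..<real n})"
    using assms by (intro negligible_countable_Union) auto
  moreover have "S \<subseteq> (\<Union>n::nat. S \<inter> {-real n<..<real n})"
  proof
    fix x assume "x \<in> S"
    moreover obtain n :: nat where "\<bar>x\<bar> < real n" using reals_Archimedean2 by blast
    ultimately show "x \<in> (\<Union>n::nat. S \<inter> {-real n<..<real n})"
      by (intro UN_I[of n]) (auto simp: abs_less_iff)
  qed
  ultimately show ?thesis by (rule negligible_subset)
qed

text \<open>The image intervals of the covering are disjoint and lie in an interval of length L = f
  n - f (-n). Intervals of slope at least N therefore have total length at most L / N, which is
  below e for large N.\<close>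

lemma negligible_infinite_slope:
  fixes f :: "real \<Rightarrow> real"
  assumes f: "mono f"
  shows "negligible {x. \<forall>N::nat. \<forall>\<delta>>0. \<exists>c d. c < d \<and> c \<le> x \<and> x \<le> d \<and> d - c < \<delta> \<and> real N * (d - c) \<le> f d - f c}"
    (is "negligible ?S")
proof (rule negligible_localize)
  fix n
  show "negligible (?S \<inter> {-real n<..<real n})"
    unfolding negligible_outer_le
  proof (intro allI impI)
    fix e :: real assume "e > 0"
    define L where "L = f (real n) - f (- real n)"
    have L: "L \<ge> 0" using f by (simp add: L_def mono_def)
    obtain N :: nat where N: "real N > L / e" "N > 0"
      using reals_Archimedean2[of "max 1 (L / e)"] by (metis gr0I max_less_iff_conj not_one_less_zero of_nat_0)
    obtain C where C: "countable C" "\<And>c d. (c, d) \<in> C \<Longrightarrow> c < d \<and> (\<exists>U\<in>{{-real n<..<real n}}. {c..d} \<subseteq> U)"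
      "negligible ((?S \<inter> {-real n<..<real n}) - (\<Union>(c, d)\<in>C. {c..d}))"
      "ennreal (real N) * emeasure lborel (\<Union>(c, d)\<in>C. {c..d}) \<le> emeasure lborel (\<Union>(c, d)\<in>C. {f c<..<f d})"
      by (rule Vitali_increment_ge[OF f, of "real N" "{{-real n<..<real n}}" "?S \<inter> {-real n<..<real n}"])
        (use N in auto)
    define W where "W = (\<Union>(c, d)\<in>C. {c..d})"
    have W: "W \<in> sets lborel"
      unfolding W_def using C(1) by (intro sets.countable_UN') auto
    have "(\<Union>(c, d)\<in>C. {f c<..<f d}) \<subseteq> {f (- real n)<..<f (real n)}"
    proof clarsimp
      fix c d x assume *: "(c, d) \<in> C" "f c < x" "x < f d"
      with C(2)[of c d] have "c < d" "{c..d} \<subseteq> {-real n<..<real n}" by auto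
      then have "c \<in> {-real n<..<real n}" "d \<in> {-real n<..<real n}" by (meson atLeastAtMost_iff less_imp_le order_refl subsetD)+
      then have "- real n \<le> c" "d \<le> real n" by auto
      then have "f (- real n) \<le> f c" "f d \<le> f (real n)" using f by (auto simp: mono_def)
      with * show "f (- real n) < x \<and> x < f (real n)" by auto
    qed
    then have "emeasure lborel (\<Union>(c, d)\<in>C. {f c<..<f d}) \<le> emeasure lborel {f (- real n)<..<f (real n)}"
      by (intro emeasure_mono) auto
    also have "\<dots> = ennreal L" using L by (simp add: L_def)
    finally have *: "ennreal (real N) * emeasure lborel W \<le> ennreal L"
      using C(4) unfolding W_def by (rule order_trans[rotated])
    have "emeasure lborel W = ennreal (1 / real N) * (ennreal (real N) * emeasure lborel W)"
      using N by (simp flip: mult.assoc ennreal_mult')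
    also have "\<dots> \<le> ennreal (1 / real N) * ennreal L"
      by (intro mult_left_mono *) auto
    also have "\<dots> \<le> ennreal e"
      using N \<open>e > 0\<close> L by (auto simp: field_simps simp flip: ennreal_mult' intro!: ennreal_leI)
    finally have "emeasure lborel W \<le> ennreal e" .
    from lmeasurable_almost_cover[OF _ W this, of "?S \<inter> {-real n<..<real n}"] C(3) \<open>e > 0\<close>
    show "\<exists>T. ?S \<inter> {-real n<..<real n} \<subseteq> T \<and> T \<in> lmeasurable \<and> measure lebesgue T \<le> e"
      unfolding W_def by (intro exI[of _ "(?S \<inter> {-real n<..<real n}) \<union> (\<Union>(c, d)\<in>C. {c..d})"]) auto
  qed
qed

text \<open>Covering a set by intervals of slope at most r and then, inside these, by intervals of slope
  at least R > r contracts every measurable cover by the factor r/R.\<close>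

lemma negligible_slope_gap:
  fixes f :: "real \<Rightarrow> real"
  assumes f: "mono f" and rR: "0 \<le> r" "r < R"
  shows "negligible {x. (\<forall>\<delta>>0. \<exists>c d. c < d \<and> c \<le> x \<and> x \<le> d \<and> d - c < \<delta> \<and> f d - f c \<le> r * (d - c)) \<and>
    (\<forall>\<delta>>0. \<exists>c d. c < d \<and> c \<le> x \<and> x \<le> d \<and> d - c < \<delta> \<and> R * (d - c) \<le> f d - f c)}"
    (is "negligible ?S")
proof (rule negligible_localize)
  fix n
  define S where "S = ?S \<inter> {-real n<..<real n}"
  \<comment> \<open>\<open>S\<close> is not known to be measurable, so its size is taken from
    outside: \<open>m\<close> is its outer measure, and the goal is m = 0.\<close>
  define M where "M = {measure lebesgue T |T. S \<subseteq> T \<and> T \<in> lmeasurable}"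
  define m where "m = Inf M"
  have bdd: "bdd_below M" by (auto simp: M_def bdd_below_def intro!: exI[of _ 0])
  have "measure lebesgue {-real n<..<real n} \<in> M"
    unfolding M_def S_def by blast
  then have ne: "M \<noteq> {}" by blast
  have m0: "m \<ge> 0" unfolding m_def using ne by (intro cInf_greatest) (auto simp: M_def)
  have contract: "m \<le> (r / R) * (measure lebesgue T + e)" if T: "S \<subseteq> T" "T \<in> lmeasurable" and "e > 0" for T e
  proof -
    obtain U where U: "open U" "T \<subseteq> U" "U \<in> lmeasurable" "measure lebesgue U < measure lebesgue T + e"
      using lmeasurable_open_cover[OF T(2) \<open>e > 0\<close>] by blast
    obtain C where C: "countable C" "\<And>c d. (c, d) \<in> C \<Longrightarrow> c < d \<and> {c..d} \<subseteq> U"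
      "negligible (S - (\<Union>(c, d)\<in>C. {c..d}))"
      "emeasure lborel (\<Union>(c, d)\<in>C. {f c<..<f d}) \<le> ennreal r * emeasure lborel (\<Union>(c, d)\<in>C. {c..d})"
      by (rule Vitali_increment_le[OF f rR(1) U(1), of S]) (use T U in \<open>auto simp: S_def\<close>)
    \<comment> \<open>The second covering needs open sets; the end points lost by passing to
      interiors are countably many, hence null.\<close>
    define \<V> where "\<V> = (\<lambda>(c, d). {c<..<d}) ` C"
    define V where "V = \<Union>\<V>"
    have \<V>: "open X" if "X \<in> \<V>" for X using that unfolding \<V>_def by auto
    obtain D where D: "countable D" "\<And>c d. (c, d) \<in> D \<Longrightarrow> c < d \<and> (\<exists>X\<in>\<V>. {c..d} \<subseteq> X)"
      "negligible (S \<inter> V - (\<Union>(c, d)\<in>D. {c..d}))"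
      "ennreal R * emeasure lborel (\<Union>(c, d)\<in>D. {c..d}) \<le> emeasure lborel (\<Union>(c, d)\<in>D. {f c<..<f d})"
      by (rule Vitali_increment_ge[OF f _ \<V>, of R \<V> "S \<inter> V"]) (use rR in \<open>auto simp: S_def V_def\<close>)
    define W where "W = (\<Union>(c, d)\<in>D. {c..d})"
    have W: "W \<in> sets lborel"
      unfolding W_def using D(1) by (intro sets.countable_UN') auto
    have "negligible ((fst ` C) \<union> (snd ` C))"
      using C(1) by (simp add: negligible_iff_null_sets null_sets_completionI countable_imp_null_set_lborel)
    then have "negligible ((S - (\<Union>(c, d)\<in>C. {c..d})) \<union> (S \<inter> V - W) \<union> ((fst ` C) \<union> (snd ` C)))"
      using C(1,3) D(3) by (intro negligible_Un) (auto simp: W_def)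
    then have neg: "negligible (S - W)"
      by (rule negligible_subset) (force simp: V_def \<V>_def)
    \<comment> \<open>Nesting and monotonicity put each image interval of \<open>D\<close> inside
      one of \<open>C\<close>. This links the lower slope bound R of one covering to the upper slope
      bound r of the other.\<close>
    have "(\<Union>(c, d)\<in>D. {f c<..<f d}) \<subseteq> (\<Union>(c, d)\<in>C. {f c<..<f d})"
    proof
      fix y assume "y \<in> (\<Union>(c, d)\<in>D. {f c<..<f d})"
      then obtain c d where cd: "(c, d) \<in> D" and y: "f c < y" "y < f d" by auto
      obtain c' d' where C': "(c', d') \<in> C" "{c..d} \<subseteq> {c'<..<d'}" and "c < d"
        using D(2)[OF cd] by (auto simp: \<V>_def)
      then have "c \<in> {c'<..<d'}" "d \<in> {c'<..<d'}" by (meson atLeastAtMost_iff less_imp_le order_refl subsetD)+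
      then have "f c' \<le> f c" "f d \<le> f d'" using f by (auto simp: mono_def)
      with C' y show "y \<in> (\<Union>(c, d)\<in>C. {f c<..<f d})" by (intro UN_I[OF C'(1)]) auto
    qed
    then have "emeasure lborel (\<Union>(c, d)\<in>D. {f c<..<f d}) \<le> emeasure lborel (\<Union>(c, d)\<in>C. {f c<..<f d})"
      using C(1) by (intro emeasure_mono) (auto intro!: sets.countable_UN')
    with D(4) have "ennreal R * emeasure lborel W \<le> emeasure lborel (\<Union>(c, d)\<in>C. {f c<..<f d})"
      unfolding W_def by (rule order_trans)
    also have "\<dots> \<le> ennreal r * emeasure lborel (\<Union>(c, d)\<in>C. {c..d})" by fact
    also have "\<dots> \<le> ennreal r * emeasure lborel U"
      using C(2) U(1) by (intro mult_left_mono emeasure_mono) auto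
    also have "\<dots> \<le> ennreal r * ennreal (measure lebesgue T + e)"
    proof (intro mult_left_mono)
      have "emeasure lborel U = emeasure lebesgue U" using U(1) by simp
      also have "\<dots> = ennreal (measure lebesgue U)" by (rule emeasure_eq_measure2[OF U(3)])
      also have "\<dots> \<le> ennreal (measure lebesgue T + e)" using U(4) by (intro ennreal_leI) simp
      finally show "emeasure lborel U \<le> ennreal (measure lebesgue T + e)" .
    qed simp
    finally have *: "ennreal R * emeasure lborel W \<le> ennreal r * ennreal (measure lebesgue T + e)" .
    have "emeasure lborel W = ennreal (1 / R) * (ennreal R * emeasure lborel W)"
      using rR by (simp flip: mult.assoc ennreal_mult')
    also have "\<dots> \<le> ennreal (1 / R) * (ennreal r * ennreal (measure lebesgue T + e))"
      by (intro mult_left_mono *) auto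
    also have "\<dots> = ennreal (r / R * (measure lebesgue T + e))"
      using rR \<open>e > 0\<close> by (simp add: field_simps flip: ennreal_mult' mult.assoc ennreal_plus)
    finally have "emeasure lborel W \<le> ennreal (r / R * (measure lebesgue T + e))" .
    from lmeasurable_almost_cover[OF neg W this] rR \<open>e > 0\<close>
    have "measure lebesgue (S \<union> W) \<in> M" "measure lebesgue (S \<union> W) \<le> r / R * (measure lebesgue T + e)"
      by (auto simp: M_def)
    then show ?thesis
      unfolding m_def using bdd by (meson cInf_lower order_trans)
  qed
  have contract': "m \<le> r / R * (m + e)" if e: "e > 0" for e
  proof -
    obtain T where "S \<subseteq> T" "T \<in> lmeasurable" "measure lebesgue T < m + e / 2"
      using cInf_lessD[OF ne, of "m + e / 2"] e unfolding m_def[symmetric] by (auto simp: M_def)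
    then have "m \<le> r / R * (measure lebesgue T + e / 2)" "measure lebesgue T + e / 2 \<le> m + e"
      using contract[of T "e / 2"] e by auto
    then show ?thesis
      using rR by (meson divide_nonneg_pos dual_order.trans le_less_trans mult_left_mono)
  qed
  have "m \<le> r / R * m + e" if "e > 0" for e
  proof -
    have "m \<le> r / R * m + r / R * e"
      using contract'[OF that] by (simp add: distrib_left)
    moreover have "r / R * e \<le> 1 * e" using that rR by (intro mult_right_mono) auto
    ultimately show ?thesis by simp
  qed
  then have "m \<le> r / R * m" by (rule field_le_epsilon)
  then have "m * (R - r) \<le> 0" using rR by (simp add: field_simps)
  then have "m = 0" using m0 rR by (simp add: mult_le_0_iff)
  then show "negligible (?S \<inter> {-real n<..<real n})"
    unfolding negligible_outer S_def[symmetric]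
    using cInf_lessD[OF ne] unfolding m_def[symmetric] by (auto simp: M_def)
qed

text \<open>Slopes of intervals that contain the point, instead of one-sided difference quotients, reduce
  the four Dini derivatives to an upper and a lower one.\<close>

theorem mono_imp_differentiable_ae:
  fixes f :: "real \<Rightarrow> real"
  assumes f: "mono f"
  shows "negligible {x. \<not> f differentiable (at x)}"
proof -
  define A where "A = (\<lambda>r R. {x. (\<forall>\<delta>>0. \<exists>c d. c < d \<and> c \<le> x \<and> x \<le> d \<and> d - c < \<delta> \<and> f d - f c \<le> r * (d - c)) \<and>
    (\<forall>\<delta>>0. \<exists>c d. c < d \<and> c \<le> x \<and> x \<le> d \<and> d - c < \<delta> \<and> R * (d - c) \<le> f d - f c)})"
  define B where "B = {x. \<forall>N::nat. \<forall>\<delta>>0. \<exists>c d. c < d \<and> c \<le> x \<and> x \<le> d \<and> d - c < \<delta> \<and> real N * (d - c) \<le> f d - f c}"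
  \<comment> \<open>Rational pairs suffice to separate a lower from an upper derivative and keep the
    union of exceptional sets countable.\<close>
  define Q where "Q = {(r, R). r \<in> \<rat> \<and> R \<in> \<rat> \<and> 0 \<le> r \<and> r < (R::real)}"
  have "Q \<subseteq> \<rat> \<times> \<rat>" by (auto simp: Q_def)
  then have "countable Q"
    by (rule countable_subset) (intro countable_SIGMA countable_rat)
  then have "negligible (B \<union> (\<Union>(r, R)\<in>Q. A r R))"
    using negligible_slope_gap[OF f] negligible_infinite_slope[OF f] unfolding A_def B_def
    by (intro negligible_Un negligible_countable_Union) (auto simp: Q_def)
  moreover have "f differentiable (at x)" if B: "x \<notin> B" and A: "\<And>r R. (r, R) \<in> Q \<Longrightarrow> x \<notin> A r R" for x
  proof -
    \<comment> \<open>\<open>T\<close> collects the slopes that are strictly exceeded by all short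
      intervals around x. Its supremum is the lower derivative, finite because x lies outside
      \<open>B\<close>.\<close>
    define T where "T = {r. \<exists>\<delta>>0. \<forall>c d. c < d \<longrightarrow> c \<le> x \<longrightarrow> x \<le> d \<longrightarrow> d - c < \<delta> \<longrightarrow> r * (d - c) < f d - f c}"
    obtain N :: nat and \<delta>N where "\<delta>N > 0"
      "\<not> (\<exists>c d. c < d \<and> c \<le> x \<and> x \<le> d \<and> d - c < \<delta>N \<and> real N * (d - c) \<le> f d - f c)"
      using B unfolding B_def by blast
    then have N: "\<delta>N > 0" "\<And>c d. c < d \<Longrightarrow> c \<le> x \<Longrightarrow> x \<le> d \<Longrightarrow> d - c < \<delta>N \<Longrightarrow> f d - f c < real N * (d - c)"
      by - (assumption, meson linorder_not_le)
    have T_le: "r \<le> real N" if rT: "r \<in> T" for r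
    proof -
      obtain \<delta> where \<delta>: "\<delta> > 0" "\<And>c d. c < d \<Longrightarrow> c \<le> x \<Longrightarrow> x \<le> d \<Longrightarrow> d - c < \<delta> \<Longrightarrow> r * (d - c) < f d - f c"
        using rT unfolding T_def by blast
      define h where "h = min \<delta> \<delta>N / 2"
      have h: "h > 0" "h < \<delta>" "h < \<delta>N" using \<delta>(1) N(1) by (auto simp: h_def)
      have "r * h < f (x + h) - f x" "f (x + h) - f x < real N * h" using \<delta>(2)[of x "x + h"] N(2)[of x "x + h"] h by simp_all
      then have "r * h < real N * h" by linarith
      then show ?thesis using h by (simp add: mult_less_cancel_right)
    qed
    \<comment> \<open>Negative numbers make \<open>T\<close> nonempty and its supremum l
      nonnegative; the latter admits the rational pair chosen above l to \<open>Q\<close>.\<close>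
    have neg_T: "r \<in> T" if "r < 0" for r
    proof -
      have "r * (d - c) < f d - f c" if "c < d" for c d
      proof -
        have "r * (d - c) < 0" using \<open>r < 0\<close> that by (intro mult_neg_pos) auto
        also have "0 \<le> f d - f c" using monoD[OF f, of c d] that by simp
        finally show ?thesis .
      qed
      then show ?thesis unfolding T_def by (auto intro: exI[of _ 1])
    qed
    define l where "l = Sup T"
    have ne: "T \<noteq> {}" using neg_T[of "-1"] by auto
    have bdd: "bdd_above T" using T_le by (auto simp: bdd_above_def)
    have T_l: "r \<le> l" if "r \<in> T" for r unfolding l_def using that bdd by (rule cSup_upper)
    have l0: "l \<ge> 0" using T_l[OF neg_T] by (meson dense_le)
    have straddle: "\<exists>\<delta>>0. \<forall>c d. c < d \<longrightarrow> c \<le> x \<longrightarrow> x \<le> d \<longrightarrow> d - c < \<delta> \<longrightarrow> \<bar>f d - f c - l * (d - c)\<bar> \<le> e * (d - c)" if e: "e > 0" for e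
    proof -
      obtain r where "r \<in> T" "l - e < r"
        using less_cSupD[OF ne, of "l - e"] e unfolding l_def by auto
      then obtain \<delta>1 where 1: "\<delta>1 > 0" "\<And>c d. c < d \<Longrightarrow> c \<le> x \<Longrightarrow> x \<le> d \<Longrightarrow> d - c < \<delta>1 \<Longrightarrow> r * (d - c) < f d - f c"
        unfolding T_def by blast
      \<comment> \<open>As r' > l is not in \<open>T\<close>, slopes of at most r' recur at
        arbitrarily small scales. Since x is outside \<open>A r' R'\<close>, all short intervals
        around x then have slope below R' < l + e.\<close>
      obtain r' where r': "r' \<in> \<rat>" "l < r'" "r' < l + e"
        using Rats_dense_in_real[of l "l + e"] e by auto
      obtain R' where R': "R' \<in> \<rat>" "r' < R'" "R' < l + e"
        using Rats_dense_in_real[of r' "l + e"] r' by auto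
      have "r' \<notin> T" using T_l r'(2) by fastforce
      then have "\<forall>\<delta>>0. \<exists>c d. c < d \<and> c \<le> x \<and> x \<le> d \<and> d - c < \<delta> \<and> f d - f c \<le> r' * (d - c)"
        unfolding T_def mem_Collect_eq by (meson not_less)
      moreover have "x \<notin> A r' R'" using r' R' l0 by (intro A) (auto simp: Q_def)
      ultimately obtain \<delta>2 where 2: "\<delta>2 > 0" "\<And>c d. c < d \<Longrightarrow> c \<le> x \<Longrightarrow> x \<le> d \<Longrightarrow> d - c < \<delta>2 \<Longrightarrow> f d - f c < R' * (d - c)"
        unfolding A_def mem_Collect_eq by (meson not_le)
      have "\<bar>f d - f c - l * (d - c)\<bar> \<le> e * (d - c)"
        if cd: "c < d" "c \<le> x" "x \<le> d" "d - c < min \<delta>1 \<delta>2" for c d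
      proof -
        have "r * (d - c) < f d - f c" "f d - f c < R' * (d - c)" using 1(2)[of c d] 2(2)[of c d] cd by auto
        moreover have "(l - e) * (d - c) \<le> r * (d - c)" "R' * (d - c) \<le> (l + e) * (d - c)"
          using cd \<open>l - e < r\<close> R'(3) by (auto intro!: mult_right_mono)
        ultimately show ?thesis by (simp add: abs_le_iff algebra_simps)
      qed
      then show ?thesis using 1(1) 2(1) by (intro exI[of _ "min \<delta>1 \<delta>2"]) auto
    qed
    have "(f has_field_derivative l) (at x)"
      unfolding has_field_derivative_def has_derivative_at_alt
    proof (intro conjI allI impI)
      fix e :: real assume "e > 0"
      obtain \<delta> where \<delta>: "\<delta> > 0" "\<And>c d. c < d \<Longrightarrow> c \<le> x \<Longrightarrow> x \<le> d \<Longrightarrow> d - c < \<delta> \<Longrightarrow> \<bar>f d - f c - l * (d - c)\<bar> \<le> e * (d - c)"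
        using straddle[OF \<open>e > 0\<close>] by blast
      show "\<exists>d>0. \<forall>y. norm (y - x) < d \<longrightarrow> norm (f y - f x - l * (y - x)) \<le> e * norm (y - x)"
      proof (intro exI[of _ \<delta>] conjI allI impI \<delta>(1))
        fix y assume "norm (y - x) < \<delta>"
        then show "norm (f y - f x - l * (y - x)) \<le> e * norm (y - x)"
          using \<delta>(2)[of x y] \<delta>(2)[of y x]
          by (cases y x rule: linorder_cases) (auto simp: algebra_simps abs_if split: if_splits)
      qed
    qed (simp add: bounded_linear_mult_right)
    then show ?thesis unfolding has_field_derivative_def differentiable_def by blast
  qed
  then have "{x. \<not> f differentiable (at x)} \<subseteq> B \<union> (\<Union>(r, R)\<in>Q. A r R)" by blast
  ultimately show ?thesis by (rule negligible_subset)
qed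

section \<open>Absolutely continuous functions\<close>

lemma sum_lengths_le:
  fixes c d :: "'i \<Rightarrow> real"
  assumes "finite I" "disjoint_family_on (\<lambda>i. {c i<..<d i}) I" "\<And>i. i \<in> I \<Longrightarrow> c i \<le> d i"
    and "\<And>i. i \<in> I \<Longrightarrow> {c i<..<d i} \<subseteq> U" "U \<in> lmeasurable"
  shows "(\<Sum>i\<in>I. d i - c i) \<le> measure lebesgue U"
proof -
  have "(\<Sum>i\<in>I. d i - c i) = (\<Sum>i\<in>I. measure lebesgue {c i<..<d i})"
    using assms(3) by (intro sum.cong) auto
  also have "\<dots> = measure lebesgue (\<Union>i\<in>I. {c i<..<d i})"
    using assms(1,2) by (intro measure_UNION'[symmetric]) (auto simp: disjoint_family_on_def pairwise_def disjnt_def)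
  also have "\<dots> \<le> measure lebesgue U"
    using assms by (intro measure_mono_fmeasurable) auto
  finally show ?thesis .
qed

lemma AC_finite_family:
  fixes u :: "real \<Rightarrow> 'a::real_normed_vector"
  assumes u: "u \<in> AC a b" and "\<epsilon> > 0"
  obtains \<delta> where "\<delta> > 0" "\<And>(I :: 'i set) c d. finite I \<Longrightarrow> (\<And>i. i \<in> I \<Longrightarrow> a \<le> c i \<and> c i \<le> d i \<and> d i \<le> b) \<Longrightarrow>
    disjoint_family_on (\<lambda>i. {c i<..<d i}) I \<Longrightarrow> (\<Sum>i\<in>I. d i - c i) < \<delta> \<Longrightarrow>
    (\<Sum>i\<in>I. norm (u (d i) - u (c i))) < \<epsilon>"
proof -
  obtain \<delta> where \<delta>: "\<delta> > 0" "\<And>(n::nat) c d. (\<forall>i<n. a \<le> c i \<and> c i < d i \<and> d i \<le> b) \<Longrightarrow>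
      disjoint_family_on (\<lambda>i. {c i<..<d i}) {..<n} \<Longrightarrow> (\<Sum>i<n. d i - c i) < \<delta> \<Longrightarrow>
      (\<Sum>i<n. norm (u (d i) - u (c i))) < \<epsilon>"
    using u \<open>\<epsilon> > 0\<close> unfolding AC_def by blast
  show thesis
  proof (rule that[OF \<delta>(1)])
    fix I :: "'i set" and c d
    assume I: "finite I" "\<And>i. i \<in> I \<Longrightarrow> a \<le> c i \<and> c i \<le> d i \<and> d i \<le> b"
      "disjoint_family_on (\<lambda>i. {c i<..<d i}) I" "(\<Sum>i\<in>I. d i - c i) < \<delta>"
    define J where "J = {i \<in> I. c i \<noteq> d i}"
    have "finite J" using I(1) by (simp add: J_def)
    then obtain h where h: "bij_betw h {0..<card J} J" using ex_bij_betw_nat_finite by blast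
    then have h': "bij_betw h {..<card J} J" by (simp add: atLeast0LessThan)
    have hJ: "h i \<in> J" if "i < card J" for i using h' that by (auto simp: bij_betw_def)
    have disj: "disjoint_family_on (\<lambda>i. {c (h i)<..<d (h i)}) {..<card J}"
      unfolding disjoint_family_on_def
    proof (intro ballI impI)
      fix m n assume mn: "m \<in> {..<card J}" "n \<in> {..<card J}" "m \<noteq> n"
      then have "h m \<noteq> h n" using h' by (auto simp: bij_betw_def inj_on_def)
      then show "{c (h m)<..<d (h m)} \<inter> {c (h n)<..<d (h n)} = {}"
        using I(3) hJ[of m] hJ[of n] mn unfolding disjoint_family_on_def J_def by auto
    qed
    have re: "(\<Sum>i\<in>I. g i) = (\<Sum>i<card J. g (h i))" if "\<And>i. i \<in> I \<Longrightarrow> c i = d i \<Longrightarrow> g i = 0" for g :: "'i \<Rightarrow> real"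
    proof -
      have "(\<Sum>i\<in>I. g i) = (\<Sum>i\<in>J. g i)"
        using I(1) that by (intro sum.mono_neutral_right) (auto simp: J_def)
      also have "\<dots> = (\<Sum>i<card J. g (h i))"
        by (rule sum.reindex_bij_betw[OF h', symmetric])
      finally show ?thesis .
    qed
    have "(\<Sum>i<card J. norm (u (d (h i)) - u (c (h i)))) < \<epsilon>"
    proof (rule \<delta>(2)[OF _ disj])
      show "\<forall>i<card J. a \<le> c (h i) \<and> c (h i) < d (h i) \<and> d (h i) \<le> b"
        using hJ I(2) by (force simp: J_def)
      show "(\<Sum>i<card J. d (h i) - c (h i)) < \<delta>"
        using I(4) re[of "\<lambda>i. d i - c i"] by simp
    qed
    then show "(\<Sum>i\<in>I. norm (u (d i) - u (c i))) < \<epsilon>"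
      using re[of "\<lambda>i. norm (u (d i) - u (c i))"] by simp
  qed
qed

lemma AC_subinterval: "u \<in> AC a b \<Longrightarrow> a \<le> s \<Longrightarrow> t \<le> b \<Longrightarrow> u \<in> AC s t"
  unfolding AC_def mem_Collect_eq
proof (intro allI impI)
  fix \<epsilon> :: real assume "\<epsilon> > 0" and "a \<le> s" and "t \<le> b" and u: "\<forall>\<epsilon>>0. \<exists>\<delta>>0. \<forall>(n::nat) c d.
      (\<forall>i<n. a \<le> c i \<and> c i < d i \<and> d i \<le> b) \<longrightarrow>
      disjoint_family_on (\<lambda>i. {c i<..<d i}) {..<n} \<longrightarrow>
      (\<Sum>i<n. d i - c i) < \<delta> \<longrightarrow>
      (\<Sum>i<n. norm (u (d i) - u (c i))) < \<epsilon>"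
  then have le: "(\<forall>i<n. s \<le> c i \<and> c i < d i \<and> d i \<le> t) \<Longrightarrow> \<forall>i<n. a \<le> c i \<and> c i < d i \<and> d i \<le> b" for n::nat and c d
    by (meson order_trans)
  from u \<open>\<epsilon> > 0\<close> show "\<exists>\<delta>>0. \<forall>(n::nat) c d.
      (\<forall>i<n. s \<le> c i \<and> c i < d i \<and> d i \<le> t) \<longrightarrow>
      disjoint_family_on (\<lambda>i. {c i<..<d i}) {..<n} \<longrightarrow>
      (\<Sum>i<n. d i - c i) < \<delta> \<longrightarrow>
      (\<Sum>i<n. norm (u (d i) - u (c i))) < \<epsilon>"
    by (elim allE[of _ \<epsilon>] impE exE conjE) (use le in blast)+
qed

text \<open>Used for the coordinates of a vector-valued function, whose increments are dominated by
  those of the function.\<close>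

lemma AC_norm_le:
  assumes u: "u \<in> AC a b" and le: "\<And>s t. norm (v t - v s) \<le> norm (u t - u s)"
  shows "v \<in> AC a b"
proof -
  have *: "(\<Sum>i<n. norm (v (d i) - v (c i))) \<le> (\<Sum>i<n. norm (u (d i) - u (c i)))" for n::nat and c d
    by (intro sum_mono le)
  show ?thesis
    unfolding AC_def mem_Collect_eq
  proof (intro allI impI)
    fix \<epsilon> :: real assume "\<epsilon> > 0"
    then obtain \<delta> where "\<delta> > 0" "\<And>(n::nat) c d. \<forall>i<n. a \<le> c i \<and> c i < d i \<and> d i \<le> b \<Longrightarrow>
        disjoint_family_on (\<lambda>i. {c i<..<d i}) {..<n} \<Longrightarrow> (\<Sum>i<n. d i - c i) < \<delta> \<Longrightarrow>
        (\<Sum>i<n. norm (u (d i) - u (c i))) < \<epsilon>"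
      using u unfolding AC_def by blast
    then show "\<exists>\<delta>>0. \<forall>(n::nat) c d. (\<forall>i<n. a \<le> c i \<and> c i < d i \<and> d i \<le> b) \<longrightarrow>
        disjoint_family_on (\<lambda>i. {c i<..<d i}) {..<n} \<longrightarrow> (\<Sum>i<n. d i - c i) < \<delta> \<longrightarrow>
        (\<Sum>i<n. norm (v (d i) - v (c i))) < \<epsilon>"
      by (intro exI[of _ \<delta>]) (simp add: le_less_trans[OF *])
  qed
qed

text \<open>An interval is cut along a grid of mesh less than the modulus of absolute continuity for
  \<open>\<epsilon> = 1\<close>; the increment over a grid cell is that of the clamped end points.\<close>

lemma AC_bounded_variation:
  fixes u :: "real \<Rightarrow> 'a::real_normed_vector"
  assumes u: "u \<in> AC a b" and ab: "a < b"
  obtains B where "\<And>(I :: 'i set) c d. finite I \<Longrightarrow> (\<And>i. i \<in> I \<Longrightarrow> a \<le> c i \<and> c i \<le> d i \<and> d i \<le> b) \<Longrightarrow>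
    disjoint_family_on (\<lambda>i. {c i<..<d i}) I \<Longrightarrow> (\<Sum>i\<in>I. norm (u (d i) - u (c i))) \<le> B"
proof -
  obtain \<delta> where \<delta>: "\<delta> > 0" "\<And>(I :: 'i set) c d. finite I \<Longrightarrow> (\<And>i. i \<in> I \<Longrightarrow> a \<le> c i \<and> c i \<le> d i \<and> d i \<le> b) \<Longrightarrow>
    disjoint_family_on (\<lambda>i. {c i<..<d i}) I \<Longrightarrow> (\<Sum>i\<in>I. d i - c i) < \<delta> \<Longrightarrow>
    (\<Sum>i\<in>I. norm (u (d i) - u (c i))) < 1"
    by (rule AC_finite_family[OF u zero_less_one, where 'i = 'i]) blast
  obtain N :: nat where N: "N > 0" "(b - a) / \<delta> < real N"
    using reals_Archimedean2[of "max 1 ((b - a) / \<delta>)"] by (metis gr0I max_less_iff_conj not_one_less_zero of_nat_0)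
  define x where "x k = a + real k * ((b - a) / real N)" for k
  have x0: "x 0 = a" and xN: "x N = b" using N by (auto simp: x_def)
  have xS: "x (Suc k) = x k + (b - a) / real N" for k by (simp add: x_def algebra_simps add_divide_distrib diff_divide_distrib)
  have xpos: "(b - a) / real N > 0" using N ab by simp
  have mesh: "x (Suc k) - x k < \<delta>" for k using N \<delta>(1) by (simp add: xS field_simps)
  have xmono: "x k \<le> x (Suc k)" for k using xpos by (simp add: xS)
  have xge: "a \<le> x k" for k using ab by (simp add: x_def)
  have xle: "x k \<le> b" if "k \<le> N" for k
    unfolding xN[symmetric] using lift_Suc_mono_le[of x k N] xmono that by blast
  define cl where "cl k t = max (x k) (min t (x (Suc k)))" for k t
  \<comment> \<open>Cells to the right of t contribute 0, cells to its left their whole increment,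
    and the cell containing t the remainder, so the sum telescopes.\<close>
  have split: "u t = u a + (\<Sum>k<N. u (cl k t) - u (x k))" if t: "a \<le> t" "t \<le> b" for t
  proof -
    have "u (min t (x (Suc k))) - u (min t (x k)) = u (cl k t) - u (x k)" for k
      using xmono[of k] by (cases "t \<le> x k") (auto simp: cl_def min_def max_def)
    then have "(\<Sum>k<N. u (cl k t) - u (x k)) = (\<Sum>k<N. u (min t (x (Suc k))) - u (min t (x k)))" by simp
    also have "\<dots> = u (min t (x N)) - u (min t (x 0))" by (rule sum_lessThan_telescope)
    also have "\<dots> = u t - u a" using t by (simp add: x0 xN)
    finally show ?thesis by simp
  qed
  show thesis
  proof (rule that[of "real N"])
    fix I :: "'i set" and c d
    assume I: "finite I" "\<And>i. i \<in> I \<Longrightarrow> a \<le> c i \<and> c i \<le> d i \<and> d i \<le> b"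
      "disjoint_family_on (\<lambda>i. {c i<..<d i}) I"
    \<comment> \<open>Clamping to one cell keeps the intervals disjoint and their total length below
      \<delta>. Each of the N cells thus contributes at most 1, whence the bound
      \<open>real N\<close>.\<close>
    have piece: "(\<Sum>i\<in>I. norm (u (cl k (d i)) - u (cl k (c i)))) \<le> 1" if k: "k < N" for k
    proof -
      have bounds: "x k \<le> cl k (c i) \<and> cl k (c i) \<le> cl k (d i) \<and> cl k (d i) \<le> x (Suc k)" if "i \<in> I" for i
        using I(2)[OF that] xmono[of k] by (auto simp: cl_def)
      have sub: "{cl k (c i)<..<cl k (d i)} \<subseteq> {c i<..<d i}" for i
        by (auto simp: cl_def)
      then have disj: "disjoint_family_on (\<lambda>i. {cl k (c i)<..<cl k (d i)}) I"
        using I(3) unfolding disjoint_family_on_def by blast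
      have "(\<Sum>i\<in>I. cl k (d i) - cl k (c i)) \<le> measure lebesgue {x k..x (Suc k)}"
        using bounds by (intro sum_lengths_le I(1) disj) force+
      also have "\<dots> < \<delta>" using mesh[of k] xmono[of k] by simp
      finally show ?thesis
        using bounds disj xge[of k] xle[of "Suc k"] k
        by (intro less_imp_le \<delta>(2) I(1)) (auto intro: order_trans)
    qed
    have "(\<Sum>i\<in>I. norm (u (d i) - u (c i))) = (\<Sum>i\<in>I. norm (\<Sum>k<N. u (cl k (d i)) - u (cl k (c i))))"
    proof (intro sum.cong refl)
      fix i assume "i \<in> I"
      then have "u (d i) = u a + (\<Sum>k<N. u (cl k (d i)) - u (x k))" "u (c i) = u a + (\<Sum>k<N. u (cl k (c i)) - u (x k))"
        using I(2)[of i] by (auto intro!: split)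
      then show "norm (u (d i) - u (c i)) = norm (\<Sum>k<N. u (cl k (d i)) - u (cl k (c i)))"
        by (simp add: sum_subtractf)
    qed
    also have "\<dots> \<le> (\<Sum>i\<in>I. \<Sum>k<N. norm (u (cl k (d i)) - u (cl k (c i))))"
      by (intro sum_mono norm_sum)
    also have "\<dots> = (\<Sum>k<N. \<Sum>i\<in>I. norm (u (cl k (d i)) - u (cl k (c i))))"
      by (rule sum.swap)
    also have "\<dots> \<le> (\<Sum>k<N. 1)" using piece by (intro sum_mono) auto
    finally show "(\<Sum>i\<in>I. norm (u (d i) - u (c i))) \<le> real N" by simp
  qed
qed

text \<open>\<open>V\<close> is the total variation on \<open>[a, x]\<close>, of which only the superadditivity is needed.\<close>

lemma AC_variation_function:
  fixes u :: "real \<Rightarrow> 'a::real_normed_vector"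
  assumes u: "u \<in> AC a b" and ab: "a < b"
  obtains V :: "real \<Rightarrow> real" where "\<And>x y. a \<le> x \<Longrightarrow> x \<le> y \<Longrightarrow> y \<le> b \<Longrightarrow> V x + norm (u y - u x) \<le> V y"
proof -
  define F where "F x = {(n::nat, c, d). (\<forall>i<n. a \<le> c i \<and> c i \<le> d i \<and> d i \<le> x) \<and>
    disjoint_family_on (\<lambda>i. {c i<..<d i}) {..<n}}" for x
  define v where "v = (\<lambda>(n::nat, c, d). \<Sum>i<n. norm (u (d i) - u (c i)))"
  obtain B where B: "\<And>(I :: nat set) c d. finite I \<Longrightarrow> (\<And>i. i \<in> I \<Longrightarrow> a \<le> c i \<and> c i \<le> d i \<and> d i \<le> b) \<Longrightarrow>
    disjoint_family_on (\<lambda>i. {c i<..<d i}) I \<Longrightarrow> (\<Sum>i\<in>I. norm (u (d i) - u (c i))) \<le> B"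
    by (rule AC_bounded_variation[OF u ab, where 'i = nat]) blast
  have bdd: "bdd_above (v ` F x)" if "x \<le> b" for x
    using that unfolding v_def F_def by (intro bdd_aboveI2[of _ _ B]) (force intro!: B)
  have ne: "F x \<noteq> {}" for x
    unfolding F_def by (auto simp: disjoint_family_on_def intro!: exI[of _ 0])
  have "Sup (v ` F x) + norm (u y - u x) \<le> Sup (v ` F y)" if xy: "a \<le> x" "x \<le> y" "y \<le> b" for x y
  proof -
    have "v p \<le> Sup (v ` F y) - norm (u y - u x)" if p: "p \<in> F x" for p
    proof -
      obtain n c d where p_eq: "p = (n, c, d)" by (cases p)
      \<comment> \<open>The interval [x, y] is appended to a family in [a, x] as its member number
        n.\<close>
      define c' d' where "c' = c(n := x)" "d' = d(n := y)"
      have *: "\<forall>i<n. a \<le> c i \<and> c i \<le> d i \<and> d i \<le> x" and disj: "disjoint_family_on (\<lambda>i. {c i<..<d i}) {..<n}"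
        using p by (auto simp: F_def p_eq)
      have "disjoint_family_on (\<lambda>i. {c' i<..<d' i}) {..<Suc n}"
        using disj * by (fastforce simp: disjoint_family_on_def less_Suc_eq c'_d'_def)
      then have "(Suc n, c', d') \<in> F y"
        using * xy by (auto simp: F_def less_Suc_eq c'_d'_def)
      then have "v (Suc n, c', d') \<le> Sup (v ` F y)"
        using bdd[OF xy(3)] by (intro cSUP_upper)
      moreover have "v (Suc n, c', d') = v p + norm (u y - u x)"
        by (simp add: v_def p_eq c'_d'_def)
      ultimately show ?thesis by simp
    qed
    then have "Sup (v ` F x) \<le> Sup (v ` F y) - norm (u y - u x)"
      using ne[of x] by (intro cSUP_least)
    then show ?thesis by simp
  qed
  then show thesis by (rule that[of "\<lambda>x. Sup (v ` F x)"])
qed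

text \<open>Superadditivity of the variation \<open>V\<close> makes both V + u and V - u increasing,
  and u is half their difference.\<close>

lemma AC_real_differentiable_ae:
  fixes u :: "real \<Rightarrow> real"
  assumes u: "u \<in> AC a b" and ab: "a < b"
  shows "negligible {x \<in> {a<..<b}. \<not> u differentiable (at x)}"
proof -
  obtain V :: "real \<Rightarrow> real" where V: "\<And>x y. a \<le> x \<Longrightarrow> x \<le> y \<Longrightarrow> y \<le> b \<Longrightarrow> V x + norm (u y - u x) \<le> V y"
    by (rule AC_variation_function[OF u ab]) blast
  \<comment> \<open>Clamping extends the monotone functions from [a, b] to the whole line; near an
    interior point it is the identity and does not affect differentiability.\<close>
  define cl where "cl t = max a (min b t)" for t
  define f where "f t = V (cl t) + u (cl t)" for t
  define g where "g t = V (cl t) - u (cl t)" for t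
  have cl: "a \<le> cl s" "cl s \<le> cl t" "cl t \<le> b" if "s \<le> t" for s t using that ab by (auto simp: cl_def)
  have "mono f" "mono g"
    using V[OF cl] by (fastforce simp: mono_def f_def g_def abs_le_iff)+
  then have "negligible ({x. \<not> f differentiable (at x)} \<union> {x. \<not> g differentiable (at x)})"
    by (intro negligible_Un mono_imp_differentiable_ae)
  moreover have "u differentiable (at x)" if x: "x \<in> {a<..<b}" "f differentiable (at x)" "g differentiable (at x)" for x
  proof -
    have "(\<lambda>t. (f t - g t) / 2) differentiable (at x)"
      using x by (auto intro!: derivative_intros)
    then obtain D where "((\<lambda>t. (f t - g t) / 2) has_derivative D) (at x)"
      unfolding differentiable_def by blast
    then have "(u has_derivative D) (at x)"
      by (rule has_derivative_transform_within_open[of _ _ _ _ "{a<..<b}"]) (use x in \<open>auto simp: f_def g_def cl_def\<close>)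
    then show ?thesis unfolding differentiable_def by blast
  qed
  then have "{x \<in> {a<..<b}. \<not> u differentiable (at x)} \<subseteq> {x. \<not> f differentiable (at x)} \<union> {x. \<not> g differentiable (at x)}"
    by blast
  ultimately show ?thesis by (rule negligible_subset)
qed

lemma AC_differentiable_ae:
  fixes u :: "real \<Rightarrow> 'a::euclidean_space"
  assumes u: "u \<in> AC a b" and ab: "a < b"
  shows "negligible {x \<in> {a<..<b}. \<not> u differentiable (at x)}"
proof -
  have "(\<lambda>t. u t \<bullet> i) \<in> AC a b" if "i \<in> Basis" for i
    using u by (rule AC_norm_le) (use that in \<open>auto simp flip: inner_diff_left intro: Basis_le_norm\<close>)
  then have "negligible (\<Union>i\<in>Basis. {x \<in> {a<..<b}. \<not> (\<lambda>t. u t \<bullet> i) differentiable (at x)})"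
    using AC_real_differentiable_ae[OF _ ab] by (intro negligible_Union) auto
  then show ?thesis
    by (rule negligible_subset) (auto simp: differentiable_componentwise_within[of u])
qed

text \<open>The Riemann sum is split by its tags. At tags outside the null set, differentiability
  controls each error in proportion to the length of the interval. At the other tags the gauge
  forces the intervals into an open set of small measure, where absolute continuity makes the total
  increment of u small.\<close>

lemma AC_has_integral:
  fixes u :: "real \<Rightarrow> 'a::euclidean_space"
  assumes u: "u \<in> AC a b" and ab: "a \<le> b" and N: "negligible N"
    and f: "\<And>x. x \<in> {a<..<b} - N \<Longrightarrow> (u has_vector_derivative f x) (at x)"
  shows "(f has_integral (u b - u a)) {a..b}"
proof -
  \<comment> \<open>The end points join the exceptional set because two-sided derivatives are given
    only in the open interval. With \<open>g\<close> zero on \<open>Z\<close>, the Riemann terms at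
    bad tags vanish and only increments of u remain there.\<close>
  define Z where "Z = N \<union> {a, b}"
  define g where "g x = (if x \<in> Z then 0 else f x)" for x
  have Z: "negligible Z" unfolding Z_def using N by (intro negligible_Un) auto
  have "(g has_integral (u b - u a)) {a..b}"
    unfolding has_integral_factor_content_real
  proof (intro allI impI)
    fix e :: real assume e: "e > 0"
    show "\<exists>\<gamma>. gauge \<gamma> \<and> (\<forall>p. p tagged_division_of {a..b} \<and> \<gamma> fine p \<longrightarrow>
      norm ((\<Sum>(x, k)\<in>p. measure lborel k *\<^sub>R g x) - (u b - u a)) \<le> e * measure lborel {a..b})"
    proof (cases "a < b")
      case False
      then have [simp]: "a = b" using ab by simp
      have "norm ((\<Sum>(x, k)\<in>p. measure lborel k *\<^sub>R g x) - (u b - u a)) \<le> e * measure lborel {a..b}"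
        if "p tagged_division_of {a..b}" for p
      proof -
        have "(\<Sum>(x, k)\<in>p. measure lborel k *\<^sub>R g x) = 0"
          using that by (intro sum_content_null[of a b]) auto
        then show ?thesis by simp
      qed
      then show ?thesis using gauge_ball by blast
    next
      case True
      \<comment> \<open>Half of the permitted error e (b - a): the bad tags use one half, the good
        tags the other.\<close>
      define \<epsilon> where "\<epsilon> = e * (b - a) / 2"
      have "\<epsilon> > 0" using True e by (simp add: \<epsilon>_def)
      obtain \<delta> where \<delta>: "\<delta> > 0" "\<And>(I :: (real \<times> real set) set) c d. finite I \<Longrightarrow> (\<And>i. i \<in> I \<Longrightarrow> a \<le> c i \<and> c i \<le> d i \<and> d i \<le> b) \<Longrightarrow>
        disjoint_family_on (\<lambda>i. {c i<..<d i}) I \<Longrightarrow> (\<Sum>i\<in>I. d i - c i) < \<delta> \<Longrightarrow>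
        (\<Sum>i\<in>I. norm (u (d i) - u (c i))) < \<epsilon>"
        by (rule AC_finite_family[OF u \<open>\<epsilon> > 0\<close>, where 'i = "real \<times> real set"]) blast
      obtain U where U: "open U" "Z \<subseteq> U" "U \<in> lmeasurable" "measure lebesgue U < \<delta>"
        using lmeasurable_open_cover[OF negligible_imp_measurable[OF Z] \<delta>(1)] Z
        by (auto simp: negligible_imp_measure0)
      have "\<exists>r>0. x \<in> {a..b} - Z \<longrightarrow> (\<forall>y. norm (y - x) < r \<longrightarrow> norm (u y - u x - (y - x) *\<^sub>R f x) \<le> e / 2 * norm (y - x))" for x
      proof (cases "x \<in> {a..b} - Z")
        case True
        then have "x \<in> {a<..<b} - N" by (auto simp: Z_def)
        from f[OF this] show ?thesis
          unfolding has_vector_derivative_def has_derivative_at_alt using e half_gt_zero by blast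
      qed (auto intro: exI[of _ 1])
      then obtain r where r: "\<And>x. r x > 0" "\<And>x y. x \<in> {a..b} - Z \<Longrightarrow> norm (y - x) < r x \<Longrightarrow>
          norm (u y - u x - (y - x) *\<^sub>R f x) \<le> e / 2 * norm (y - x)"
        by metis
      define \<gamma> where "\<gamma> x = (if x \<in> Z then U else ball x (r x))" for x
      have gauge: "gauge \<gamma>" using U r(1) by (auto simp: gauge_def \<gamma>_def)
      have "norm ((\<Sum>(x, k)\<in>p. measure lborel k *\<^sub>R g x) - (u b - u a)) \<le> e * measure lborel {a..b}"
        if p: "p tagged_division_of {a..b}" and fine: "\<gamma> fine p" for p
      proof -
        note pD = tagged_division_ofD[OF p]
        define c where "c = (\<lambda>i :: real \<times> real set. Inf (snd i))"
        define d where "d = (\<lambda>i :: real \<times> real set. Sup (snd i))"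
        have k: "k = {c (x, k)..d (x, k)} \<and> a \<le> c (x, k) \<and> c (x, k) \<le> x \<and> x \<le> d (x, k) \<and> d (x, k) \<le> b" if xk: "(x, k) \<in> p" for x k
        proof -
          obtain s t where st: "k = {s..t}" using pD(4)[OF xk] by auto
          moreover have "x \<in> k" "k \<subseteq> {a..b}" using pD(2,3)[OF xk] by auto
          ultimately show ?thesis by (auto simp: c_def d_def)
        qed
        define pZ where "pZ = {i \<in> p. fst i \<in> Z}"
        have fin: "finite p" by (rule pD(1))
        have "(\<Sum>i\<in>pZ. norm (u (d i) - u (c i))) < \<epsilon>"
        proof (rule \<delta>(2))
          show "finite pZ" using fin by (simp add: pZ_def)
          show "a \<le> c i \<and> c i \<le> d i \<and> d i \<le> b" if "i \<in> pZ" for i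
            using k[of "fst i" "snd i"] that by (auto simp: pZ_def)
          show disj: "disjoint_family_on (\<lambda>i. {c i<..<d i}) pZ"
            unfolding disjoint_family_on_def
          proof (intro ballI impI)
            fix i j assume ij: "i \<in> pZ" "j \<in> pZ" "i \<noteq> j"
            then have "interior (snd i) \<inter> interior (snd j) = {}"
              using pD(5)[of "fst i" "snd i" "fst j" "snd j"] by (auto simp: pZ_def prod_eq_iff)
            moreover have "snd i = {c i..d i}" "snd j = {c j..d j}"
              using k[of "fst i" "snd i"] k[of "fst j" "snd j"] ij by (auto simp: pZ_def)
            ultimately show "{c i<..<d i} \<inter> {c j<..<d j} = {}" by simp
          qed
          have "(\<Sum>i\<in>pZ. d i - c i) \<le> measure lebesgue U"
          proof (rule sum_lengths_le[OF _ disj _ _ U(3)])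
            show "{c i<..<d i} \<subseteq> U" if "i \<in> pZ" for i
            proof -
              have "snd i \<subseteq> U" using fineD[OF fine, of "fst i" "snd i"] that by (auto simp: pZ_def \<gamma>_def)
              moreover have "snd i = {c i..d i}" using k[of "fst i" "snd i"] that by (auto simp: pZ_def)
              ultimately show ?thesis by auto
            qed
            show "c i \<le> d i" if "i \<in> pZ" for i
              using k[of "fst i" "snd i"] that by (auto simp: pZ_def)
          qed (use fin in \<open>simp add: pZ_def\<close>)
          then show "(\<Sum>i\<in>pZ. d i - c i) < \<delta>" using U(4) by simp
        qed
        moreover have "(\<Sum>i\<in>p - pZ. norm (measure lborel (snd i) *\<^sub>R g (fst i) - (u (d i) - u (c i)))) \<le> \<epsilon>"
        proof -
          have "norm (measure lborel (snd i) *\<^sub>R g (fst i) - (u (d i) - u (c i))) \<le> e / 2 * measure lborel (snd i)"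
            if i: "i \<in> p - pZ" for i
          proof -
            obtain x K where i_eq: "(x, K) = i" by (metis prod.collapse)
            obtain y z where yz: "c i = y" "d i = z" by blast
            have xZ: "x \<notin> Z" and xK: "(x, K) \<in> p" using i i_eq by (auto simp: pZ_def)
            have K: "K = {y..z}" and y: "a \<le> y" "y \<le> x" "x \<le> z" "z \<le> b"
              using k[OF xK] unfolding i_eq yz by blast+
            have ball: "K \<subseteq> ball x (r x)" using fineD[OF fine xK] xZ by (simp add: \<gamma>_def)
            have "y \<in> K" "z \<in> K" using K y by auto
            then have "norm (y - x) < r x" "norm (z - x) < r x" using ball by (auto simp: dist_norm norm_minus_commute)
            moreover have "x \<in> {a..b} - Z" using y xZ by auto
            ultimately have "norm (u y - u x - (y - x) *\<^sub>R f x) \<le> e / 2 * norm (y - x)"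
              "norm (u z - u x - (z - x) *\<^sub>R f x) \<le> e / 2 * norm (z - x)"
              using r(2) by blast+
            \<comment> \<open>The tag x lies between y and z. Subtracting the two linear
              approximation errors at x cancels \<open>u x\<close>, and |y - x| + |z - x| is the
              length of K.\<close>
            moreover have "measure lborel K *\<^sub>R g x - (u z - u y) =
              (u y - u x - (y - x) *\<^sub>R f x) - (u z - u x - (z - x) *\<^sub>R f x)"
              using K y xZ by (simp add: g_def algebra_simps)
            ultimately have "norm (measure lborel K *\<^sub>R g x - (u z - u y)) \<le> e / 2 * norm (y - x) + e / 2 * norm (z - x)"
              by (simp only:) (rule order_trans[OF norm_triangle_ineq4 add_mono])
            also have "\<dots> = e / 2 * (z - y)" using y by (simp flip: distrib_left)
            also have "\<dots> = e / 2 * measure lborel K" using K y by simp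
            finally show ?thesis unfolding yz unfolding i_eq[symmetric] by simp
          qed
          then have "(\<Sum>i\<in>p - pZ. norm (measure lborel (snd i) *\<^sub>R g (fst i) - (u (d i) - u (c i)))) \<le> (\<Sum>i\<in>p - pZ. e / 2 * measure lborel (snd i))"
            by (rule sum_mono)
          also have "\<dots> \<le> (\<Sum>i\<in>p. e / 2 * measure lborel (snd i))"
            using fin e by (intro sum_mono2) auto
          also have "\<dots> = e / 2 * (\<Sum>(x, K)\<in>p. measure lborel K)"
            by (simp add: sum_distrib_left split_beta)
          also have "\<dots> = \<epsilon>"
            using additive_content_tagged_division[of p a b] p True by (simp add: \<epsilon>_def)
          finally show ?thesis .
        qed
        moreover have eq: "(\<Sum>(x, k)\<in>p. measure lborel k *\<^sub>R g x) - (u b - u a) =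
          (\<Sum>i\<in>p. measure lborel (snd i) *\<^sub>R g (fst i) - (u (d i) - u (c i)))"
          using additive_tagged_division_1[OF ab p, of u]
          by (simp add: sum_subtractf split_beta c_def d_def)
        moreover have eq': "\<dots> = (\<Sum>i\<in>p - pZ. measure lborel (snd i) *\<^sub>R g (fst i) - (u (d i) - u (c i))) + (\<Sum>i\<in>pZ. - (u (d i) - u (c i)))"
          by (subst sum.subset_diff[of pZ p]) (auto simp: pZ_def g_def fin)
        moreover have "norm \<dots> \<le> (\<Sum>i\<in>p - pZ. norm (measure lborel (snd i) *\<^sub>R g (fst i) - (u (d i) - u (c i)))) + (\<Sum>i\<in>pZ. norm (u (d i) - u (c i)))"
          by (rule order_trans[OF norm_triangle_ineq], intro add_mono order_trans[OF norm_sum] sum_mono) (simp_all add: norm_minus_commute)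
        ultimately have "norm ((\<Sum>(x, k)\<in>p. measure lborel k *\<^sub>R g x) - (u b - u a)) \<le> \<epsilon> + \<epsilon>"
          unfolding eq eq' by linarith
        then show ?thesis using True by (simp add: \<epsilon>_def)
      qed
      then show ?thesis
        by (intro exI[of _ \<gamma>] conjI gauge) simp
    qed
  qed
  then show ?thesis
    by (rule has_integral_spike[OF Z, rotated]) (simp add: g_def)
qed

text \<open>On a division of [a, b] the integrals of the derivative are increments of u. Bounded
  variation therefore bounds the sums of their norms, which is what upgrades the gauge integral to a
  Lebesgue integral.\<close>

lemma AC_FTC:
  fixes u :: "real \<Rightarrow> 'a::euclidean_space"
  assumes u: "u \<in> AC a b" and ab: "a < b"
  shows "(\<lambda>x. vector_derivative u (at x)) absolutely_integrable_on {a..b}"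
    and "t \<in> {a..b} \<Longrightarrow> ((\<lambda>x. vector_derivative u (at x)) has_integral (u t - u a)) {a..t}"
proof -
  let ?f = "\<lambda>x. vector_derivative u (at x)"
  have int: "(?f has_integral (u t - u s)) {s..t}" if "a \<le> s" "s \<le> t" "t \<le> b" for s t
    using that by (intro AC_has_integral[OF AC_subinterval[OF u] _ AC_differentiable_ae[OF u ab]])
      (auto simp: vector_derivative_works)
  then show "t \<in> {a..b} \<Longrightarrow> (?f has_integral (u t - u a)) {a..t}" by simp
  obtain B where B: "\<And>(I :: real set set) c d. finite I \<Longrightarrow> (\<And>i. i \<in> I \<Longrightarrow> a \<le> c i \<and> c i \<le> d i \<and> d i \<le> b) \<Longrightarrow>
    disjoint_family_on (\<lambda>i. {c i<..<d i}) I \<Longrightarrow> (\<Sum>i\<in>I. norm (u (d i) - u (c i))) \<le> B"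
    by (rule AC_bounded_variation[OF u ab, where 'i = "real set"]) blast
  have "?f absolutely_integrable_on cbox a b"
  proof (rule bounded_variation_absolutely_integrable_interval)
    show "?f integrable_on cbox a b" using int[of a b] ab by (auto simp: integrable_on_def)
    fix D assume D: "D division_of cbox a b"
    note DD = division_ofD[OF D]
    have KD: "K = {Inf K..Sup K} \<and> a \<le> Inf K \<and> Inf K \<le> Sup K \<and> Sup K \<le> b" if K: "K \<in> D" for K
    proof -
      obtain s t where st: "K = {s..t}" using DD(4)[OF K] by auto
      moreover have "K \<noteq> {}" "K \<subseteq> {a..b}" using DD(2,3)[OF K] by auto
      ultimately show ?thesis by auto
    qed
    have "(\<Sum>K\<in>D. norm (integral K ?f)) = (\<Sum>K\<in>D. norm (u (Sup K) - u (Inf K)))"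
    proof (intro sum.cong refl)
      fix L assume "L \<in> D"
      have "(?f has_integral (u (Sup L) - u (Inf L))) {Inf L..Sup L}"
        using KD[OF \<open>L \<in> D\<close>] by (intro int) auto
      then show "norm (integral L ?f) = norm (u (Sup L) - u (Inf L))"
        using KD[OF \<open>L \<in> D\<close>] by (metis integral_unique)
    qed
    also have "\<dots> \<le> B"
    proof (rule B[OF DD(1)])
      show "disjoint_family_on (\<lambda>K. {Inf K<..<Sup K}) D"
        unfolding disjoint_family_on_def
      proof (intro ballI impI)
        fix L M assume LM: "L \<in> D" "M \<in> D" "L \<noteq> M"
        then have "interior L \<inter> interior M = {}" using DD(5) by blast
        then show "{Inf L<..<Sup L} \<inter> {Inf M<..<Sup M} = {}"
          using KD[OF LM(1)] KD[OF LM(2)] by (metis interior_atLeastAtMost_real)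
      qed
    qed (use KD in blast)
    finally show "(\<Sum>K\<in>D. norm (integral K ?f)) \<le> B" .
  qed
  then show "?f absolutely_integrable_on {a..b}" by simp
qed

section \<open>Fractional integrals\<close>

lemma sigma_finite_lebesgue: "sigma_finite_measure (lebesgue :: 'a::euclidean_space measure)"
proof
  obtain A :: "'a set set" where "countable A" "A \<subseteq> sets lborel" "\<Union>A = space lborel" "\<forall>a\<in>A. emeasure lborel a \<noteq> \<infinity>"
    using lborel.sigma_finite_countable by blast
  then show "\<exists>A::'a set set. countable A \<and> A \<subseteq> sets lebesgue \<and> \<Union>A = space lebesgue \<and> (\<forall>a\<in>A. emeasure lebesgue a \<noteq> \<infinity>)"
    by (intro exI[of _ A]) (auto simp: subset_iff)
qed

interpretation lebesgue: sigma_finite_measure "lebesgue :: 'a::euclidean_space measure"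
  by (rule sigma_finite_lebesgue)

interpretation lebesgue_pair: pair_sigma_finite "lebesgue :: 'a::euclidean_space measure" "lebesgue :: 'b::euclidean_space measure" ..

text \<open>The completion only adds measurable sets, so each coordinate stays Borel measurable.
  This makes explicit kernels in both variables measurable on the product of completions.\<close>

lemma borel_measurable_fst_lebesgue [measurable]: "fst \<in> borel_measurable (lebesgue \<Otimes>\<^sub>M M)"
  and borel_measurable_snd_lebesgue [measurable]: "snd \<in> borel_measurable (M \<Otimes>\<^sub>M lebesgue)"
proof -
  have "(\<lambda>x. x) \<in> lebesgue \<rightarrow>\<^sub>M borel" by (auto intro!: measurable_completion)
  then show "fst \<in> borel_measurable (lebesgue \<Otimes>\<^sub>M M)" "snd \<in> borel_measurable (M \<Otimes>\<^sub>M lebesgue)"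
    using measurable_compose[OF measurable_fst] measurable_compose[OF measurable_snd] by blast+
qed

text \<open>The substitution x = (\<tau> - s) / (t - s) leads to
  \<open>Beta (1 - \<alpha>) \<alpha>\<close>. The powers of 1 / (t - s) have total exponent 1 -
  \<alpha> + (\<alpha> - 1) = 0, so the value depends neither on s nor on t.\<close>

lemma Beta_kernel_has_integral:
  fixes s t \<alpha> :: real
  assumes "s < t" "0 < \<alpha>" "\<alpha> < 1"
  shows "((\<lambda>\<tau>. (t - \<tau>) powr (\<alpha> - 1) * (\<tau> - s) powr (- \<alpha>)) has_integral (Gamma \<alpha> * Gamma (1 - \<alpha>))) {s..t}"
proof -
  define m c where "m = 1 / (t - s)" and "c = - s / (t - s)"
  have m: "m > 0" using assms by (simp add: m_def)
  have "((\<lambda>x. x powr ((1 - \<alpha>) - 1) * (1 - x) powr (\<alpha> - 1)) has_integral Beta (1 - \<alpha>) \<alpha>) (cbox 0 1)"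
    using has_integral_Beta_real[of "1 - \<alpha>" \<alpha>] assms by simp
  from has_integral_affinity'[OF this m, of c]
  have "((\<lambda>x. (m * x + c) powr (- \<alpha>) * (1 - (m * x + c)) powr (\<alpha> - 1)) has_integral Beta (1 - \<alpha>) \<alpha> / m) {(0 - c) / m..(1 - c) / m}"
    by (simp add: divide_inverse mult.commute)
  moreover have "(0 - c) / m = s" "(1 - c) / m = t" using assms by (simp_all add: m_def c_def field_simps)
  ultimately have "((\<lambda>x. (m * x + c) powr (- \<alpha>) * (1 - (m * x + c)) powr (\<alpha> - 1)) has_integral Beta (1 - \<alpha>) \<alpha> / m) {s..t}"
    by simp
  from has_integral_mult_right[OF this, of m]
  have "((\<lambda>x. m * ((m * x + c) powr (- \<alpha>) * (1 - (m * x + c)) powr (\<alpha> - 1))) has_integral (Gamma \<alpha> * Gamma (1 - \<alpha>))) {s..t}"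
    using m by (simp add: Beta_def mult.commute)
  then show ?thesis
  proof (rule has_integral_eq[rotated])
    fix x assume x: "x \<in> {s..t}"
    have 1: "m * x + c = m * (x - s)" "1 - (m * x + c) = m * (t - x)"
    proof -
      have "m * (t - s) = 1" using assms by (simp add: m_def)
      moreover show "m * x + c = m * (x - s)" by (simp add: m_def c_def diff_divide_distrib)
      ultimately show "1 - (m * x + c) = m * (t - x)" by (simp add: algebra_simps)
    qed
    have "m * (m powr (- \<alpha>) * m powr (\<alpha> - 1)) = m powr (1 + (- \<alpha> + (\<alpha> - 1)))"
      using m by (simp only: powr_add powr_one)
    also have "\<dots> = 1" using m by simp
    finally have 2: "m * (m powr (- \<alpha>) * m powr (\<alpha> - 1)) = 1" .
    have "m * ((m * x + c) powr (- \<alpha>) * (1 - (m * x + c)) powr (\<alpha> - 1)) =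
      (m * (m powr (- \<alpha>) * m powr (\<alpha> - 1))) * ((t - x) powr (\<alpha> - 1) * (x - s) powr (- \<alpha>))"
      unfolding 1(2) unfolding 1(1) using m x by (simp add: powr_mult)
    then show "m * ((m * x + c) powr (- \<alpha>) * (1 - (m * x + c)) powr (\<alpha> - 1)) = (t - x) powr (\<alpha> - 1) * (x - s) powr (- \<alpha>)"
      unfolding 2 by simp
  qed
qed

text \<open>Up to Gamma factors, the kernel that arises when fractional integrals of orders \<alpha>
  and 1 - \<alpha> are composed. Extension by zero encodes the triangular domain of integration, so
  that Fubini's theorem applies on the full product.\<close>

definition Abel_kernel :: "real \<Rightarrow> real \<Rightarrow> real \<Rightarrow> real \<Rightarrow> real" where
  "Abel_kernel \<alpha> t s \<tau> = (if s < \<tau> \<and> \<tau> < t then (t - \<tau>) powr (\<alpha> - 1) * (\<tau> - s) powr (- \<alpha>) else 0)"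

lemma Abel_kernel_nonneg: "0 \<le> Abel_kernel \<alpha> t s \<tau>"
  by (simp add: Abel_kernel_def)

lemma Abel_kernel_integral:
  assumes "0 < \<alpha>" "\<alpha> < 1"
  shows "integrable lebesgue (Abel_kernel \<alpha> t s)"
    and "s < t \<Longrightarrow> (\<integral>\<tau>. Abel_kernel \<alpha> t s \<tau> \<partial>lebesgue) = Gamma \<alpha> * Gamma (1 - \<alpha>)"
proof -
  have "has_bochner_integral lebesgue (Abel_kernel \<alpha> t s) (Gamma \<alpha> * Gamma (1 - \<alpha>))" if "s < t"
  proof -
    have "((\<lambda>\<tau>. (t - \<tau>) powr (\<alpha> - 1) * (\<tau> - s) powr (- \<alpha>)) has_integral (Gamma \<alpha> * Gamma (1 - \<alpha>))) {s<..<t}"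
      using Beta_kernel_has_integral[OF that assms] by (simp add: has_integral_Icc_iff_Ioo)
    then have "((\<lambda>\<tau>. if \<tau> \<in> {s<..<t} then (t - \<tau>) powr (\<alpha> - 1) * (\<tau> - s) powr (- \<alpha>) else 0) has_integral (Gamma \<alpha> * Gamma (1 - \<alpha>))) UNIV"
      by (simp only: has_integral_restrict_UNIV)
    then have "(Abel_kernel \<alpha> t s has_integral (Gamma \<alpha> * Gamma (1 - \<alpha>))) UNIV"
      by (simp add: Abel_kernel_def[abs_def])
    moreover from this have abs: "Abel_kernel \<alpha> t s absolutely_integrable_on UNIV"
      by (intro nonnegative_absolutely_integrable_1) (auto simp: Abel_kernel_nonneg integrable_on_def)
    moreover note set_lebesgue_integral_eq_integral(2)[OF abs]
    ultimately show ?thesis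
      by (simp add: has_bochner_integral_iff set_integrable_def set_lebesgue_integral_def integral_unique)
  qed
  moreover have "Abel_kernel \<alpha> t s = (\<lambda>_. 0)" if "\<not> s < t"
    using that by (auto simp: Abel_kernel_def fun_eq_iff)
  ultimately show "integrable lebesgue (Abel_kernel \<alpha> t s)"
    "s < t \<Longrightarrow> (\<integral>\<tau>. Abel_kernel \<alpha> t s \<tau> \<partial>lebesgue) = Gamma \<alpha> * Gamma (1 - \<alpha>)"
    by (cases "s < t"; simp add: has_bochner_integral_iff)+
qed

text \<open>This is the semigroup law for the orders \<alpha> and 1 - \<alpha>, multiplied by
  \<open>Gamma \<alpha>\<close>. After the exchange of integrations the integral over \<tau> is the
  same constant for every s < t, and only the plain integral of f remains.\<close>

lemma RL_integral_compose:
  fixes f :: "real \<Rightarrow> 'a::{banach, second_countable_topology}"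
  assumes \<alpha>: "0 < \<alpha>" "\<alpha> < 1" and f: "set_integrable lebesgue {a<..<t} f"
  shows "(LINT \<tau>:{a<..<t}|lebesgue. (t - \<tau>) powr (\<alpha> - 1) *\<^sub>R RL_integral a (1 - \<alpha>) f \<tau>) =
    Gamma \<alpha> *\<^sub>R (LINT s:{a<..<t}|lebesgue. f s)"
proof -
  define f0 where "f0 s = indicator {a<..<t} s *\<^sub>R f s" for s
  define H where "H = (\<lambda>s \<tau>. Abel_kernel \<alpha> t s \<tau> *\<^sub>R f0 s)"
  have f0: "integrable lebesgue f0"
    using f unfolding set_integrable_def f0_def .
  note borel_measurable_integrable[OF f0, measurable]
  have H[measurable]: "case_prod H \<in> borel_measurable (lebesgue \<Otimes>\<^sub>M lebesgue)"
    unfolding H_def Abel_kernel_def split_beta by measurable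
  have int: "integrable (lebesgue \<Otimes>\<^sub>M lebesgue) (case_prod H)"
  proof (rule lebesgue_pair.Fubini_integrable[OF H])
    \<comment> \<open>Since \<open>f0\<close> vanishes for s \<ge> t, the constant value of the Abel
      integral can be used for every s, and Fubini's hypothesis reduces to integrability of
      f.\<close>
    have "(\<integral>\<tau>. norm (case_prod H (s, \<tau>)) \<partial>lebesgue) = (Gamma \<alpha> * Gamma (1 - \<alpha>)) * norm (f0 s)" for s
      using Abel_kernel_integral(2)[OF \<alpha>, of s t] Abel_kernel_nonneg
      by (cases "s < t") (auto simp: H_def f0_def)
    then show "integrable lebesgue (\<lambda>s. \<integral>\<tau>. norm (case_prod H (s, \<tau>)) \<partial>lebesgue)"
      using f0 by simp
    show "AE s in lebesgue. integrable lebesgue (\<lambda>\<tau>. case_prod H (s, \<tau>))"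
      using Abel_kernel_integral(1)[OF \<alpha>] by (auto simp: H_def)
  qed
  \<comment> \<open>This holds for every \<tau>, even where the inner integrand is not integrable:
    both sides then carry the same default value 0 of the integral.\<close>
  have "(\<integral>s. H s \<tau> \<partial>lebesgue) = indicator {a<..<t} \<tau> *\<^sub>R (t - \<tau>) powr (\<alpha> - 1) *\<^sub>R (Gamma (1 - \<alpha>) *\<^sub>R RL_integral a (1 - \<alpha>) f \<tau>)" for \<tau>
  proof (cases "\<tau> \<in> {a<..<t}")
    case True
    have "H s \<tau> = (t - \<tau>) powr (\<alpha> - 1) *\<^sub>R (indicator {a<..<\<tau>} s *\<^sub>R (\<tau> - s) powr (- \<alpha>) *\<^sub>R f s)" for s
      using True by (auto simp: H_def Abel_kernel_def f0_def indicator_def)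
    then have "(\<integral>s. H s \<tau> \<partial>lebesgue) = (t - \<tau>) powr (\<alpha> - 1) *\<^sub>R (\<integral>s. indicator {a<..<\<tau>} s *\<^sub>R (\<tau> - s) powr (- \<alpha>) *\<^sub>R f s \<partial>lebesgue)"
      by (simp only: integral_scaleR_right)
    moreover have "Gamma (1 - \<alpha>) \<noteq> 0" using \<alpha> by (intro less_imp_neq[symmetric] Gamma_real_pos) simp
    ultimately show ?thesis using True \<alpha>
      by (simp add: RL_integral_def set_lebesgue_integral_def)
  next
    case False
    then have "H s \<tau> = 0" for s by (auto simp: H_def Abel_kernel_def f0_def indicator_def)
    with False show ?thesis by simp
  qed
  then have "(\<integral>\<tau>. (\<integral>s. H s \<tau> \<partial>lebesgue) \<partial>lebesgue) =
    (LINT \<tau>:{a<..<t}|lebesgue. Gamma (1 - \<alpha>) *\<^sub>R ((t - \<tau>) powr (\<alpha> - 1) *\<^sub>R RL_integral a (1 - \<alpha>) f \<tau>))"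
    unfolding set_lebesgue_integral_def by (simp add: mult.commute)
  also have "\<dots> = Gamma (1 - \<alpha>) *\<^sub>R (LINT \<tau>:{a<..<t}|lebesgue. (t - \<tau>) powr (\<alpha> - 1) *\<^sub>R RL_integral a (1 - \<alpha>) f \<tau>)"
    by (rule set_integral_scaleR_right)
  finally have "Gamma (1 - \<alpha>) *\<^sub>R (LINT \<tau>:{a<..<t}|lebesgue. (t - \<tau>) powr (\<alpha> - 1) *\<^sub>R RL_integral a (1 - \<alpha>) f \<tau>) =
    (\<integral>s. (\<integral>\<tau>. H s \<tau> \<partial>lebesgue) \<partial>lebesgue)"
    using lebesgue_pair.Fubini_integral[OF int] by simp
  also have "(\<lambda>s. \<integral>\<tau>. H s \<tau> \<partial>lebesgue) = (\<lambda>s. (Gamma \<alpha> * Gamma (1 - \<alpha>)) *\<^sub>R f0 s)"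
  proof
    show "(\<integral>\<tau>. H s \<tau> \<partial>lebesgue) = (Gamma \<alpha> * Gamma (1 - \<alpha>)) *\<^sub>R f0 s" for s
      using Abel_kernel_integral(1)[OF \<alpha>, of t s] Abel_kernel_integral(2)[OF \<alpha>, of s t]
      by (cases "s < t") (simp_all add: H_def, simp add: f0_def)
  qed
  also have "(\<integral>s. (Gamma \<alpha> * Gamma (1 - \<alpha>)) *\<^sub>R f0 s \<partial>lebesgue) = Gamma (1 - \<alpha>) *\<^sub>R (Gamma \<alpha> *\<^sub>R (LINT s:{a<..<t}|lebesgue. f s))"
    by (simp only: integral_scaleR_right) (simp add: f0_def set_lebesgue_integral_def mult.commute)
  finally show ?thesis
    using less_imp_neq[OF Gamma_real_pos[of "1 - \<alpha>"]] \<alpha> by (subst (asm) scaleR_cancel_left) auto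
qed

text \<open>The variable upper limit moves into the integrand as the condition s < t; the integral
  over one factor of a jointly measurable function is measurable. Hoelder's inequality needs this
  for the Caputo derivative.\<close>

lemma RL_integral_measurable:
  fixes f :: "real \<Rightarrow> 'a::{banach, second_countable_topology}"
  assumes f: "set_borel_measurable lebesgue {a<..<b} f"
  shows "set_borel_measurable lebesgue {a<..<b} (RL_integral a \<alpha> f)"
proof (cases "\<alpha> = 0")
  case True
  then have "RL_integral a \<alpha> f = f" by (simp add: RL_integral_def fun_eq_iff)
  then show ?thesis using f by simp
next
  case False
  define f0 where "f0 s = indicator {a<..<b} s *\<^sub>R f s" for s
  have [measurable]: "f0 \<in> borel_measurable lebesgue"
    using f unfolding set_borel_measurable_def f0_def .
  define H where "H = (\<lambda>t s. (if s < t then (t - s) powr (\<alpha> - 1) else 0) *\<^sub>R f0 s)"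
  have "case_prod H \<in> borel_measurable (lebesgue \<Otimes>\<^sub>M lebesgue)"
    unfolding H_def split_beta by measurable
  then have [measurable]: "(\<lambda>t. \<integral>s. H t s \<partial>lebesgue) \<in> borel_measurable lebesgue"
    by (rule lebesgue.borel_measurable_lebesgue_integral)
  have eq: "indicator {a<..<b} t *\<^sub>R RL_integral a \<alpha> f t = indicator {a<..<b} t *\<^sub>R (1 / Gamma \<alpha>) *\<^sub>R (\<integral>s. H t s \<partial>lebesgue)" for t
  proof (cases "t \<in> {a<..<b}")
    case True
    then have "H t s = indicator {a<..<t} s *\<^sub>R (t - s) powr (\<alpha> - 1) *\<^sub>R f s" for s
      by (auto simp: H_def f0_def indicator_def)
    then show ?thesis using False by (simp add: RL_integral_def set_lebesgue_integral_def)
  qed simp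
  then show ?thesis
    unfolding set_borel_measurable_def eq
    by (intro borel_measurable_scaleR borel_measurable_indicator borel_measurable_const) simp_all
qed

lemma caputo_representation:
  fixes u :: "real \<Rightarrow> 'a::euclidean_space"
  assumes u: "u \<in> AC a b" "u a = 0" and \<alpha>: "0 < \<alpha>" "\<alpha> \<le> 1" and t: "a < t" "t \<le> b"
  shows "(LINT \<tau>:{a<..<t}|lebesgue. (t - \<tau>) powr (\<alpha> - 1) *\<^sub>R caputo_deriv a \<alpha> u \<tau>) = Gamma \<alpha> *\<^sub>R u t"
proof -
  let ?f = "\<lambda>x. vector_derivative u (at x)"
  have ab: "a < b" using t by simp
  have "?f absolutely_integrable_on {a<..<t}"
    by (rule set_integrable_subset[OF AC_FTC(1)[OF u(1) ab]]) (use t in auto)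
  moreover have "(?f has_integral u t) {a<..<t}"
    using AC_FTC(2)[OF u(1) ab, of t] t u(2) by (simp add: has_integral_Icc_iff_Ioo)
  ultimately have f: "set_integrable lebesgue {a<..<t} ?f" "(LINT s:{a<..<t}|lebesgue. ?f s) = u t"
    by (auto simp: set_lebesgue_integral_eq_integral integral_unique)
  \<comment> \<open>Order 1 is separate because the composition law requires \<alpha> < 1. In that
    case the inner integral has order 0 and the kernel equals 1.\<close>
  show ?thesis
  proof (cases "\<alpha> = 1")
    case True
    have "(LINT \<tau>:{a<..<t}|lebesgue. (t - \<tau>) powr (\<alpha> - 1) *\<^sub>R caputo_deriv a \<alpha> u \<tau>) = (LINT s:{a<..<t}|lebesgue. ?f s)"
      using True by (intro set_lebesgue_integral_cong) (auto simp: caputo_deriv_def RL_integral_def)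
    then show ?thesis using f(2) True by simp
  next
    case False
    then show ?thesis
      using RL_integral_compose[OF \<alpha>(1) _ f(1)] \<alpha>(2) f(2) by (simp add: caputo_deriv_def)
  qed
qed

lemma caputo_measurable:
  fixes u :: "real \<Rightarrow> 'a::euclidean_space"
  assumes u: "u \<in> AC a b" "a < b"
  shows "set_borel_measurable lebesgue {a<..<b} (caputo_deriv a \<alpha> u)"
proof -
  have "set_integrable lebesgue {a<..<b} (\<lambda>x. vector_derivative u (at x))"
    by (rule set_integrable_subset[OF AC_FTC(1)[OF u]]) auto
  then show ?thesis unfolding caputo_deriv_def
    by (intro RL_integral_measurable) (auto simp: set_integrable_def set_borel_measurable_def)
qed

lemma AC_continuous_on:
  fixes u :: "real \<Rightarrow> 'a::real_normed_vector"
  assumes u: "u \<in> AC a b"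
  shows "continuous_on {a..b} u"
  unfolding continuous_on_iff
proof (intro ballI allI impI)
  fix x e :: real assume x: "x \<in> {a..b}" and e: "0 < e"
  obtain \<delta> where \<delta>: "\<delta> > 0" "\<And>(I :: unit set) c d. finite I \<Longrightarrow> (\<And>i. i \<in> I \<Longrightarrow> a \<le> c i \<and> c i \<le> d i \<and> d i \<le> b) \<Longrightarrow>
    disjoint_family_on (\<lambda>i. {c i<..<d i}) I \<Longrightarrow> (\<Sum>i\<in>I. d i - c i) < \<delta> \<Longrightarrow>
    (\<Sum>i\<in>I. norm (u (d i) - u (c i))) < e"
    by (rule AC_finite_family[OF u e, where 'i = unit]) blast
  show "\<exists>\<delta>>0. \<forall>y\<in>{a..b}. dist y x < \<delta> \<longrightarrow> dist (u y) (u x) < e"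
  proof (intro exI[of _ \<delta>] conjI ballI impI \<delta>(1))
    fix y assume "y \<in> {a..b}" "dist y x < \<delta>"
    then have "norm (u (max x y) - u (min x y)) < e"
      using \<delta>(2)[of UNIV "\<lambda>_. min x y" "\<lambda>_. max x y"] x
      by (auto simp: disjoint_family_on_def dist_norm UNIV_unit max_def min_def split: if_splits)
    then show "dist (u y) (u x) < e"
      by (auto simp: dist_norm norm_minus_commute max_def min_def split: if_splits)
  qed
qed

section \<open>The interpolation inequality\<close>

text \<open>Young's inequality is integrated for the normalised functions f / F and g / G. Weights
  \<theta>, 1 - \<theta> and upper bounds F, G suit both applications: kernel against derivative
  with \<theta> = 1 - 1/q, and interpolation with \<theta> = \<gamma> s / q.\<close>

lemma powr_Hoelder_nn_integral:
  fixes f g :: "'a \<Rightarrow> real"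
  assumes [measurable]: "f \<in> borel_measurable M" "g \<in> borel_measurable M"
    and nonneg: "\<And>x. 0 \<le> f x" "\<And>x. 0 \<le> g x"
    and \<theta>: "0 < \<theta>" "\<theta> < 1"
    and F: "(\<integral>\<^sup>+x. ennreal (f x) \<partial>M) \<le> ennreal F" "0 \<le> F"
    and G: "(\<integral>\<^sup>+x. ennreal (g x) \<partial>M) \<le> ennreal G" "0 \<le> G"
  shows "(\<integral>\<^sup>+x. ennreal (f x powr \<theta> * g x powr (1 - \<theta>)) \<partial>M) \<le> ennreal (F powr \<theta> * G powr (1 - \<theta>))"
proof (cases "F = 0 \<or> G = 0")
  \<comment> \<open>A zero bound rules out normalisation, but then one of the functions vanishes
    almost everywhere.\<close>
  case True
  then have "(\<integral>\<^sup>+x. ennreal (f x) \<partial>M) = 0 \<or> (\<integral>\<^sup>+x. ennreal (g x) \<partial>M) = 0"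
    using F(1) G(1) by auto
  then have "(AE x in M. ennreal (f x) = 0) \<or> (AE x in M. ennreal (g x) = 0)"
    by (simp add: nn_integral_0_iff_AE)
  then have "AE x in M. ennreal (f x powr \<theta> * g x powr (1 - \<theta>)) = 0"
  proof
    assume "AE x in M. ennreal (f x) = 0"
    then show ?thesis
    proof eventually_elim
      case (elim x)
      then have "f x = 0" using nonneg(1)[of x] by (simp add: ennreal_eq_0_iff)
      then show ?case by simp
    qed
  next
    assume "AE x in M. ennreal (g x) = 0"
    then show ?thesis
    proof eventually_elim
      case (elim x)
      then have "g x = 0" using nonneg(2)[of x] by (simp add: ennreal_eq_0_iff)
      then show ?case by simp
    qed
  qed
  then have "(\<integral>\<^sup>+x. ennreal (f x powr \<theta> * g x powr (1 - \<theta>)) \<partial>M) = 0"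
    by (simp add: nn_integral_0_iff_AE)
  then show ?thesis by simp
next
  case False
  then have pos: "F > 0" "G > 0" using F(2) G(2) by auto
  define K where "K = F powr \<theta> * G powr (1 - \<theta>)"
  have K: "K > 0" using pos by (simp add: K_def)
  have "f x powr \<theta> * g x powr (1 - \<theta>) \<le> K * \<theta> / F * f x + K * (1 - \<theta>) / G * g x" for x
  proof (cases "f x = 0 \<or> g x = 0")
    case True
    then show ?thesis using nonneg[of x] \<theta> pos K by auto
  next
    case False
    then have "f x > 0" "g x > 0" using nonneg[of x] by auto
    then have "(f x / F) powr \<theta> * (g x / G) powr (1 - \<theta>) \<le> \<theta> * (f x / F) + (1 - \<theta>) * (g x / G)"
      using \<theta> pos by (intro Youngs_inequality_0) auto
    then have "K * ((f x / F) powr \<theta> * (g x / G) powr (1 - \<theta>)) \<le> K * (\<theta> * (f x / F) + (1 - \<theta>) * (g x / G))"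
      using K by (intro mult_left_mono) auto
    moreover have "K * ((f x / F) powr \<theta> * (g x / G) powr (1 - \<theta>)) = f x powr \<theta> * g x powr (1 - \<theta>)"
      using nonneg[of x] pos by (simp add: K_def powr_divide)
    ultimately show ?thesis by (simp add: algebra_simps)
  qed
  then have "(\<integral>\<^sup>+x. ennreal (f x powr \<theta> * g x powr (1 - \<theta>)) \<partial>M) \<le> (\<integral>\<^sup>+x. ennreal (K * \<theta> / F) * ennreal (f x) + ennreal (K * (1 - \<theta>) / G) * ennreal (g x) \<partial>M)"
    using nonneg \<theta> pos K by (intro nn_integral_mono) (simp flip: ennreal_mult ennreal_plus)
  also have "\<dots> = ennreal (K * \<theta> / F) * (\<integral>\<^sup>+x. ennreal (f x) \<partial>M) + ennreal (K * (1 - \<theta>) / G) * (\<integral>\<^sup>+x. ennreal (g x) \<partial>M)"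
    by (simp add: nn_integral_add nn_integral_cmult)
  also have "\<dots> \<le> ennreal (K * \<theta> / F) * ennreal F + ennreal (K * (1 - \<theta>) / G) * ennreal G"
    using F(1) G(1) by (intro add_mono mult_left_mono) auto
  also have "\<dots> = ennreal K"
    using \<theta> pos K by (simp add: field_simps flip: ennreal_mult ennreal_plus)
  finally show ?thesis by (simp add: K_def)
qed

lemma nn_integral_powr_kernel:
  fixes a t e :: real
  assumes "a \<le> t" "- 1 < e"
  shows "(\<integral>\<^sup>+\<tau>. ennreal (indicator {a<..<t} \<tau> * (t - \<tau>) powr e) \<partial>lebesgue) = ennreal ((t - a) powr (e + 1) / (e + 1))"
proof -
  have "((\<lambda>x. x powr e) has_integral ((t - a) powr (e + 1) / (e + 1))) {0..t - a}"
    using has_integral_powr_from_0[of e "t - a"] assms by simp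
  then have "((\<lambda>x. (- x) powr e) has_integral ((t - a) powr (e + 1) / (e + 1))) {- (t - a)..- 0}"
    by (subst has_integral_reflect_real) simp
  then have "((\<lambda>x. (- x) powr e) has_integral ((t - a) powr (e + 1) / (e + 1))) (cbox (- (t - a)) 0)"
    by simp
  from has_integral_affinity'[OF this zero_less_one, of "- t"]
  have "((\<lambda>\<tau>. (t - \<tau>) powr e) has_integral ((t - a) powr (e + 1) / (e + 1))) {a..t}"
    by simp
  then have "(\<integral>\<^sup>+\<tau>. ennreal (indicator {a<..<t} \<tau> * (t - \<tau>) powr e) \<partial>lborel) = ennreal ((t - a) powr (e + 1) / (e + 1))"
    by (intro nn_integral_has_integral_lebesgue) (simp_all add: has_integral_Icc_iff_Ioo)
  then show ?thesis by (simp add: nn_integral_completion)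
qed

text \<open>The exponent is (\<alpha> - 1) q' for the conjugate exponent q' = 1 / (1 - 1/q). Being
  above -1 is integrability of the q'-th power of the kernel at its singularity.\<close>

lemma Abel_exponent_gt:
  fixes q \<alpha> :: real
  assumes "1 < q" "1 / q < \<alpha>"
  shows "- 1 < (\<alpha> - 1) / (1 - 1 / q)"
proof -
  have "1 - 1 / q > 0" using assms(1) by simp
  then show ?thesis using assms(2) by (simp add: pos_less_divide_eq)
qed

text \<open>Hoelder's inequality applied to the representation of u. The factor before
  \<open>F powr (1 / q)\<close> is the L^q' norm of the kernel on an interval of length b - a,
  divided by \<open>Gamma \<alpha>\<close>.\<close>

lemma caputo_sup_bound:
  fixes u :: "real \<Rightarrow> 'a::euclidean_space"
  assumes u: "u \<in> AC a b" "u a = 0" and q: "1 < q" and \<alpha>: "1 / q < \<alpha>" "\<alpha> \<le> 1"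
    and F: "(\<integral>\<^sup>+x\<in>{a<..<b}. ennreal (norm (caputo_deriv a \<alpha> u x) powr q) \<partial>lebesgue) = ennreal F" "0 \<le> F"
    and t: "t \<in> {a..b}"
    and e: "e = (\<alpha> - 1) / (1 - 1 / q)"
  shows "norm (u t) \<le> ((b - a) powr (e + 1) / (e + 1)) powr (1 - 1 / q) / Gamma \<alpha> * F powr (1 / q)"
proof (cases "t = a")
  case True
  have "\<alpha> > 0" using \<alpha>(1) q by (meson divide_pos_pos less_trans zero_less_one)
  then show ?thesis using True u(2) by (simp add: Gamma_real_pos less_imp_le)
next
  case False
  then have t': "a < t" "t \<le> b" and ab: "a < b" using t by auto
  have \<alpha>0: "\<alpha> > 0" using \<alpha>(1) q by (meson divide_pos_pos less_trans zero_less_one)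
  define \<theta> where "\<theta> = 1 - 1 / q"
  have \<theta>: "0 < \<theta>" "\<theta> < 1" using q by (auto simp: \<theta>_def)
  have e1: "e > -1" unfolding e by (rule Abel_exponent_gt[OF q \<alpha>(1)])
  define D where "D \<tau> = indicator {a<..<b} \<tau> *\<^sub>R caputo_deriv a \<alpha> u \<tau>" for \<tau>
  have [measurable]: "D \<in> borel_measurable lebesgue"
    using caputo_measurable[OF u(1) ab] unfolding set_borel_measurable_def D_def .
  have [measurable]: "(\<lambda>x::real. x) \<in> borel_measurable lebesgue" by (auto intro!: measurable_completion)
  have [measurable]: "{a<..<t} \<in> sets lebesgue" by simp
  \<comment> \<open>With \<open>g\<close> below, powers are chosen so that f^\<theta> is the kernel,
    by e \<theta> = \<alpha> - 1, and g^(1 - \<theta>) is the norm of the Caputo derivative, by q (1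
    - \<theta>) = 1.\<close>
  define f where "f \<tau> = indicator {a<..<t} \<tau> * (t - \<tau>) powr e" for \<tau>
  have [measurable]: "f \<in> borel_measurable lebesgue" unfolding f_def by (auto intro!: measurable_completion)
  define g where "g \<tau> = norm (D \<tau>) powr q" for \<tau>
  have fF: "(\<integral>\<^sup>+\<tau>. ennreal (f \<tau>) \<partial>lebesgue) \<le> ennreal ((b - a) powr (e + 1) / (e + 1))"
    unfolding f_def using t' e1
    by (subst nn_integral_powr_kernel) (auto intro!: ennreal_leI divide_right_mono powr_mono2)
  have gG: "(\<integral>\<^sup>+\<tau>. ennreal (g \<tau>) \<partial>lebesgue) \<le> ennreal F"
    unfolding F(1)[symmetric] by (intro nn_integral_mono) (auto simp: g_def D_def indicator_def)
  have H: "(\<integral>\<^sup>+\<tau>. ennreal (f \<tau> powr \<theta> * g \<tau> powr (1 - \<theta>)) \<partial>lebesgue) \<le> ennreal (((b - a) powr (e + 1) / (e + 1)) powr \<theta> * F powr (1 - \<theta>))"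
    by (rule powr_Hoelder_nn_integral[OF _ _ _ _ \<theta> fF _ gG F(2)]) (use e1 in \<open>auto simp: f_def g_def\<close>)
  have pw: "norm (indicator {a<..<t} \<tau> *\<^sub>R (t - \<tau>) powr (\<alpha> - 1) *\<^sub>R caputo_deriv a \<alpha> u \<tau>) = f \<tau> powr \<theta> * g \<tau> powr (1 - \<theta>)" for \<tau>
  proof (cases "\<tau> \<in> {a<..<t}")
    case True
    have "e * \<theta> = \<alpha> - 1" using \<theta> by (simp add: e \<theta>_def)
    moreover have "q * (1 - \<theta>) = 1" using q by (simp add: \<theta>_def)
    ultimately show ?thesis using True t' by (simp add: f_def g_def D_def powr_powr)
  qed (simp add: f_def)
  \<comment> \<open>If the integrand is not integrable, its Bochner integral is 0 by convention and
    the bound is trivial.\<close>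
  have "ennreal (norm (LINT \<tau>:{a<..<t}|lebesgue. (t - \<tau>) powr (\<alpha> - 1) *\<^sub>R caputo_deriv a \<alpha> u \<tau>)) \<le>
     (\<integral>\<^sup>+\<tau>. ennreal (f \<tau> powr \<theta> * g \<tau> powr (1 - \<theta>)) \<partial>lebesgue)"
  proof (cases "integrable lebesgue (\<lambda>\<tau>. indicator {a<..<t} \<tau> *\<^sub>R (t - \<tau>) powr (\<alpha> - 1) *\<^sub>R caputo_deriv a \<alpha> u \<tau>)")
    case True
    from integral_norm_bound_ennreal[OF this] show ?thesis
      unfolding pw set_lebesgue_integral_def .
  qed (simp add: set_lebesgue_integral_def not_integrable_integral_eq)
  also note H
  finally have "ennreal (norm (Gamma \<alpha> *\<^sub>R u t)) \<le> ennreal (((b - a) powr (e + 1) / (e + 1)) powr \<theta> * F powr (1 - \<theta>))"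
    unfolding caputo_representation[OF u \<alpha>0 \<alpha>(2) t'] .
  then have "Gamma \<alpha> * norm (u t) \<le> ((b - a) powr (e + 1) / (e + 1)) powr \<theta> * F powr (1 - \<theta>)"
    using Gamma_real_pos[OF \<alpha>0] by simp
  then show ?thesis
    using Gamma_real_pos[OF \<alpha>0] by (simp add: \<theta>_def field_simps)
qed

section \<open>Interpolation of norms with values in [0, \<infinity>]\<close>

lemma ennreal_powr_ennreal: "0 \<le> x \<Longrightarrow> r \<noteq> 0 \<Longrightarrow> ennreal_powr (ennreal x) r = ennreal (x powr r)"
  by (simp add: ennreal_powr_def)

lemma ennreal_powr_mono_ennreal: "0 < r \<Longrightarrow> x \<le> ennreal y \<Longrightarrow> 0 \<le> y \<Longrightarrow> ennreal_powr x r \<le> ennreal (y powr r)"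
  by (cases x) (auto simp: ennreal_powr_ennreal top_unique intro!: ennreal_leI powr_mono2)

text \<open>The constant is explicit and independent of the codomain, so that the real and the
  complex case share it. \<open>K\<close> bounds the supremum of u by the norm of its Caputo
  derivative, \<open>(b - a) powr (1 / q)\<close> turns this into an L^q bound, and interpolation
  contributes the power s.\<close>

lemma Caputo_Gagliardo_Nirenberg:
  fixes u :: "real \<Rightarrow> 'a::euclidean_space"
  assumes ab: "a < b" and p: "1 \<le> p" and q: "1 < q" and \<alpha>: "1 / q < \<alpha>" "\<alpha> \<le> 1"
    and s: "0 \<le> s" "s \<le> 1" and \<gamma>: "\<gamma> > 0" "\<gamma> * s / q + \<gamma> * (1 - s) / p = 1"
    and e: "e = (\<alpha> - 1) / (1 - 1 / q)"
    and K: "K = ((b - a) powr (e + 1) / (e + 1)) powr (1 - 1 / q) / Gamma \<alpha>"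
    and u: "u \<in> AC a b" "u a = 0"
  shows "Lnorm \<gamma> a b u \<le> ennreal (((b - a) powr (1 / q) * K) powr s) *
        ennreal_powr (Lnorm q a b (caputo_deriv a \<alpha> u)) s * ennreal_powr (Lnorm p a b u) (1 - s)"
proof -
  have \<alpha>0: "\<alpha> > 0" using \<alpha>(1) q by (meson divide_pos_pos less_trans zero_less_one)
  have K0: "K \<ge> 0" unfolding K using Gamma_real_pos[OF \<alpha>0] by (simp add: less_imp_le)
  have "e + 1 \<noteq> 0" using Abel_exponent_gt[OF q \<alpha>(1)] by (simp add: e)
  then have BK: "(b - a) powr (1 / q) * K > 0"
    unfolding K using ab Gamma_real_pos[OF \<alpha>0] by simp
  define C where "C = ((b - a) powr (1 / q) * K) powr s"
  define v where "v x = indicator {a<..<b} x *\<^sub>R u x" for x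
  have "continuous_on {a<..<b} u" using AC_continuous_on[OF u(1)] by (rule continuous_on_subset) auto
  then have "(\<lambda>x. indicator {a<..<b} x *\<^sub>R u x) \<in> borel_measurable borel"
    by (intro borel_measurable_continuous_on_indicator) auto
  then have [measurable]: "v \<in> borel_measurable lebesgue"
    unfolding v_def by (intro measurable_completion) simp
  define I where "I r = (\<integral>\<^sup>+x. ennreal (norm (v x) powr r) \<partial>lebesgue)" for r
  have I_eq: "(\<integral>\<^sup>+x\<in>{a<..<b}. ennreal (norm (u x) powr r) \<partial>lebesgue) = I r" if "r > 0" for r
    unfolding I_def by (intro nn_integral_cong) (auto simp: v_def indicator_def)
  have L: "Lnorm r a b u = ennreal_powr (I r) (1 / r)" if "r > 0" for r
    by (simp add: Lnorm_def I_eq[OF that])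
  have I_bound: "I r \<le> ennreal ((b - a) * M powr r)" if M: "\<And>t. t \<in> {a..b} \<Longrightarrow> norm (u t) \<le> M" and "r > 0" for M r
  proof -
    have "M \<ge> 0" using M[of a] ab u(2) by simp
    have "I r \<le> (\<integral>\<^sup>+x. ennreal (M powr r) * indicator {a<..<b} x \<partial>lebesgue)"
      unfolding I_def using M \<open>r > 0\<close> by (intro nn_integral_mono) (auto simp: v_def indicator_def intro!: ennreal_leI powr_mono2)
    also have "\<dots> = ennreal ((b - a) * M powr r)"
      using ab by (simp add: nn_integral_cmult_indicator mult.commute flip: ennreal_mult)
    finally show ?thesis .
  qed
  show ?thesis
  proof (cases "s = 0")
    \<comment> \<open>Hoelder's weights lie strictly between 0 and 1, so s = 0 and s = 1 are treated
      apart. For s = 0 one has \<gamma> = p and both sides agree.\<close>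
    case True
    then have "\<gamma> = p" using \<gamma> p by simp
    moreover have "ennreal_powr x 1 = x" for x by (cases x) (auto simp: ennreal_powr_def)
    moreover have "C = 1" using less_imp_neq[OF BK] True by (simp add: C_def)
    ultimately show ?thesis unfolding C_def[symmetric] using True by (simp add: ennreal_powr_def)
  next
    case False
    then have s0: "s > 0" using s by simp
    show ?thesis
    proof (cases "(\<integral>\<^sup>+x\<in>{a<..<b}. ennreal (norm (caputo_deriv a \<alpha> u x) powr q) \<partial>lebesgue)")
      case (real F)
      define M where "M = K * F powr (1 / q)"
      have M: "norm (u t) \<le> M" if "t \<in> {a..b}" for t
        unfolding M_def K by (rule caputo_sup_bound[OF u q \<alpha> real(2,1) that e])
      have LD: "Lnorm q a b (caputo_deriv a \<alpha> u) = ennreal (F powr (1 / q))"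
        unfolding Lnorm_def real(2) using real(1) q by (simp add: ennreal_powr_ennreal)
      have CD: "ennreal C * ennreal_powr (Lnorm q a b (caputo_deriv a \<alpha> u)) s = ennreal (((b - a) powr (1 / q) * M) powr s)"
        unfolding LD using s0 K0 real(1)
        by (simp add: ennreal_powr_ennreal C_def M_def powr_mult mult.assoc flip: ennreal_mult)
      \<comment> \<open>\<open>X\<close> bounds the integral of |u|^q through the supremum bound
        \<open>M\<close>; its q-th root is the factor \<open>(b - a) powr (1 / q) * M\<close>
        already found in the constant.\<close>
      define X where "X = (b - a) * M powr q"
      have M0: "M \<ge> 0" using K0 by (simp add: M_def)
      have X0: "X \<ge> 0" using ab by (simp add: X_def)
      have IX: "I q \<le> ennreal X" unfolding X_def by (rule I_bound[OF M]) (use q in auto)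
      have Xq: "X powr (1 / q) = (b - a) powr (1 / q) * M"
        using M0 q ab by (simp add: X_def powr_mult powr_powr)
      show ?thesis
      proof (cases "s = 1")
        case True
        then have "\<gamma> = q" using \<gamma> q by simp
        have "Lnorm q a b u \<le> ennreal (X powr (1 / q))"
          unfolding L[of q, OF less_trans[OF zero_less_one q]] using IX X0 q by (intro ennreal_powr_mono_ennreal) auto
        also have "\<dots> = ennreal (((b - a) powr (1 / q) * M) powr s)"
          unfolding Xq using True M0 by simp
        finally show ?thesis
          unfolding C_def[symmetric] CD \<open>\<gamma> = q\<close> using True by (simp add: ennreal_powr_def)
      next
        case False
        then have s1: "s < 1" using s by simp
        have "I p \<noteq> top" using I_bound[OF M, of p] p by (auto simp: top_unique)
        then obtain Y where Y: "I p = ennreal Y" "Y \<ge> 0" by (cases "I p") auto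
        \<comment> \<open>The relation defining \<gamma> says that this weight and \<gamma> (1 - s)
          / p add up to 1. Hence q \<theta> + p (1 - \<theta>) = \<gamma>, which splits the
          \<gamma>-th power of |u|.\<close>
        define \<theta> where "\<theta> = \<gamma> * s / q"
        have \<theta>': "1 - \<theta> = \<gamma> * (1 - s) / p" using \<gamma>(2) by (simp add: \<theta>_def)
        have "\<theta> > 0" using \<gamma>(1) s0 q by (simp add: \<theta>_def)
        moreover have "1 - \<theta> > 0" unfolding \<theta>' using \<gamma>(1) s1 p by simp
        ultimately have \<theta>: "0 < \<theta>" "\<theta> < 1" by auto
        have "norm (v x) powr \<gamma> = (norm (v x) powr q) powr \<theta> * (norm (v x) powr p) powr (1 - \<theta>)" for x
        proof -
          have "q * \<theta> + p * (1 - \<theta>) = \<gamma>"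
          proof -
            have "q * \<theta> = \<gamma> * s" "p * (1 - \<theta>) = \<gamma> * (1 - s)"
              unfolding \<theta>' unfolding \<theta>_def using p q by simp_all
            then show ?thesis by (simp add: algebra_simps)
          qed
          then show ?thesis by (simp add: powr_powr flip: powr_add)
        qed
        then have "I \<gamma> = (\<integral>\<^sup>+x. ennreal ((norm (v x) powr q) powr \<theta> * (norm (v x) powr p) powr (1 - \<theta>)) \<partial>lebesgue)"
          by (simp add: I_def)
        also have "\<dots> \<le> ennreal (X powr \<theta> * Y powr (1 - \<theta>))"
          by (rule powr_Hoelder_nn_integral[OF _ _ _ _ \<theta> _ X0 _ Y(2)]) (use IX Y in \<open>auto simp: I_def\<close>)
        finally have "Lnorm \<gamma> a b u \<le> ennreal ((X powr \<theta> * Y powr (1 - \<theta>)) powr (1 / \<gamma>))"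
          unfolding L[OF \<gamma>(1)] using \<gamma>(1) by (intro ennreal_powr_mono_ennreal) auto
        also have "(X powr \<theta> * Y powr (1 - \<theta>)) powr (1 / \<gamma>) = (X powr (1 / q)) powr s * (Y powr (1 / p)) powr (1 - s)"
          unfolding \<theta>' unfolding \<theta>_def using \<gamma>(1) by (simp add: powr_mult powr_powr)
        also have "ennreal \<dots> = ennreal (((b - a) powr (1 / q) * M) powr s) * ennreal_powr (Lnorm p a b u) (1 - s)"
          using p s1 Y by (simp add: Xq L ennreal_powr_ennreal ennreal_mult)
        finally show ?thesis unfolding C_def[symmetric] CD .
      qed
    next
      case top
      have D: "ennreal_powr (Lnorm q a b (caputo_deriv a \<alpha> u)) s = \<infinity>"
        unfolding Lnorm_def top using s0 q by (simp add: ennreal_powr_def)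
      \<comment> \<open>The right-hand side is infinite unless its last factor is 0. In that case
        the product is 0, but u vanishes almost everywhere, so the left-hand side is 0 as
        well.\<close>
      show ?thesis
      proof (cases "ennreal_powr (Lnorm p a b u) (1 - s) = 0")
        case True
        then have "I p = 0"
          using p by (cases "I p") (auto simp: L ennreal_powr_def ennreal_eq_0_iff split: if_splits)
        then have "AE x in lebesgue. ennreal (norm (v x) powr p) = 0"
          unfolding I_def by (subst (asm) nn_integral_0_iff_AE) auto
        then have "AE x in lebesgue. ennreal (norm (v x) powr \<gamma>) = 0"
          by eventually_elim (auto simp: ennreal_eq_0_iff)
        then have "I \<gamma> = 0" unfolding I_def by (subst nn_integral_0_iff_AE) auto
        then show ?thesis using \<gamma>(1) by (simp add: L ennreal_powr_def)
      next
        case False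
        moreover have "C > 0" using less_imp_neq[OF BK] unfolding C_def by simp
        ultimately show ?thesis
          unfolding D C_def[symmetric] by (simp add: ennreal_mult_top ennreal_top_mult)
      qed
    qed
  qed
qed

theorem theorem3p9:
  fixes a b p q \<alpha> s \<gamma> :: real
  assumes "a < b"
    and "1 \<le> p" and "1 \<le> q"
    and "1 / q < \<alpha>" and "\<alpha> \<le> 1"
    and "0 \<le> s" and "s \<le> 1"
    and "\<gamma> > 0"
    and "\<gamma> * s / q + \<gamma> * (1 - s) / p = 1"
  shows "\<exists>C::real. C > 0 \<and>
    (\<forall>u::real \<Rightarrow> real. u \<in> AC a b \<longrightarrow> u a = 0 \<longrightarrow>
      Lnorm \<gamma> a b u \<le> ennreal C *
        ennreal_powr (Lnorm q a b (caputo_deriv a \<alpha> u)) s * ennreal_powr (Lnorm p a b u) (1 - s)) \<and>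
    (\<forall>u::real \<Rightarrow> complex. u \<in> AC a b \<longrightarrow> u a = 0 \<longrightarrow>
      Lnorm \<gamma> a b u \<le> ennreal C *
        ennreal_powr (Lnorm q a b (caputo_deriv a \<alpha> u)) s * ennreal_powr (Lnorm p a b u) (1 - s))"
proof -
  have q: "1 < q" using assms(3-5) by (cases "q = 1") auto
  then have \<alpha>0: "\<alpha> > 0" using assms(4) by (meson divide_pos_pos less_trans zero_less_one)
  define e where "e = (\<alpha> - 1) / (1 - 1 / q)"
  define K where "K = ((b - a) powr (e + 1) / (e + 1)) powr (1 - 1 / q) / Gamma \<alpha>"
  have "e + 1 \<noteq> 0" using Abel_exponent_gt[OF q assms(4)] by (simp add: e_def)
  then have "((b - a) powr (1 / q) * K) powr s > 0"
    using assms(1) Gamma_real_pos[OF \<alpha>0] by (simp add: K_def)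
  then show ?thesis
    by (intro exI[of _ "((b - a) powr (1 / q) * K) powr s"] conjI allI impI
      Caputo_Gagliardo_Nirenberg[OF assms(1,2) q assms(4-9) e_def K_def])
qed

end
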